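(* Let $k$ be a positive integer and let $q_{n,j}$ ($n\ge1$, $1\le j\le k$) be natural numbers with $$q_{1,1}<q_{1,2}<\cdots<q_{1,k}<q_{2,1}<q_{2,2}<\cdots<q_{2,k}<q_{3,1}<\cdots,$$ such that $q_{n,j}\mid q_{n,j+1}$ for $1\le j\le k-1$ and $q_{n,k}\mid q_{n+1,1}$ for all $n\ge1$, and such that $$\lim_{n\to\infty}\frac{\log q_{n+1,1}-\log q_{n,k}}{\log q_{n+1,k}}=\eta_1,\qquad \lim_{n\to\infty}\frac{\log q_{n+1,i}-\log q_{n+1,i-1}}{\log q_{n+1,k}}=\eta_i\ (2\le i\le k),\qquad \lim_{n\to\infty}\frac{\log q_{n+1,1}}{\log q_{n,k}}=\eta_{k+1}=\infty,$$ where the real numbers $\eta_1,\dots,\eta_k$ satisfy $\eta_1+\eta_2+\cdots+\eta_k=1$ and $\eta_k\ge\eta_{k-1}\ge\cdots\ge\eta_1>0$. Put $\zeta_j=\sum_{n\ge1}\frac{1}{q_{n,j}}$ for $1\le j\le k$. Then the approximation constants of $(\zeta_1,\dots,\zeta_k)$ are $$\omega_1=\infty,\qquad \omega_j=\max_{j-1\le m\le k}\frac{\eta_{m-j+2}}{\eta_1+\eta_2+\cdots+\eta_m}\quad(2\le j\le k+1),$$ $$\widehat\omega_1=\min_{1\le m\le k}\frac{\eta_m}{\eta_1+\eta_2+\cdots+\eta_m},\qquad \widehat\omega_j=0\quad(2\le j\le k+1).$$ (In particular $\omega_2=\max\{\eta_k/(\eta_k+\cdots+\eta_1),\eta_{k-1}/(\eta_{k-1}+\cdots+\eta_1),\dots,\eta_1/\eta_1\}$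 and $\omega_{k+1}=\eta_1/(\eta_k+\cdots+\eta_1)$.)
   Context: For real $\zeta_1,\dots,\zeta_k$, $1\le j\le k+1$ and $X>0$, let $\omega_j(X)$ be the supremum of all real $\nu$ such that the system $|x|\le X$, $|\zeta_ix-y_i|\le X^{-\nu}$ ($1\le i\le k$) has $j$ linearly independent solutions $(x,y_1,\dots,y_k)\in\mathbb{Z}^{k+1}$. Then $\omega_j=\limsup_{X\to\infty}\omega_j(X)$ and $\widehat\omega_j=\liminf_{X\to\infty}\omega_j(X)$; also $\omega=\omega_1$, $\widehat\omega=\widehat\omega_1$. *)

theory Defs
  imports "HOL-Analysis.Analysis" "HOL-Library.Liminf_Limsup"
begin

text \<open>Integer vectors in Z^(k+1) are functions nat => int, coordinate 0 is x,
  coordinates 1..k are y_1..y_k. A family v 0, ..., v (j-1) of such vectors is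
  linearly independent (over the reals, equivalently over Q).\<close>
definition lin_indep_fam :: "nat \<Rightarrow> nat \<Rightarrow> (nat \<Rightarrow> nat \<Rightarrow> int) \<Rightarrow> bool" where
  "lin_indep_fam k j v \<longleftrightarrow>
     (\<forall>c :: nat \<Rightarrow> real. (\<forall>i\<le>k. (\<Sum>l<j. c l * of_int (v l i)) = 0) \<longrightarrow> (\<forall>l<j. c l = 0))"

definition omega_X :: "nat \<Rightarrow> (nat \<Rightarrow> real) \<Rightarrow> nat \<Rightarrow> real \<Rightarrow> ereal" where
  "omega_X k \<zeta> j X = Sup {ereal \<nu> | \<nu>. \<exists>v :: nat \<Rightarrow> nat \<Rightarrow> int. lin_indep_fam k j v \<and>
      (\<forall>l<j. \<bar>real_of_int (v l 0)\<bar> \<le> X \<and>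
        (\<forall>i\<in>{1..k}. \<bar>\<zeta> i * of_int (v l 0) - of_int (v l i)\<bar> \<le> X powr (-\<nu>)))}"

definition omega :: "nat \<Rightarrow> (nat \<Rightarrow> real) \<Rightarrow> nat \<Rightarrow> ereal" where
  "omega k \<zeta> j = Limsup at_top (omega_X k \<zeta> j)"

definition omega_hat :: "nat \<Rightarrow> (nat \<Rightarrow> real) \<Rightarrow> nat \<Rightarrow> ereal" where
  "omega_hat k \<zeta> j = Liminf at_top (omega_X k \<zeta> j)"

end

theory Submission
  imports Defs
begin

text \<open>
  Consider the block \<open>a 0 = q n k\<close>, \<open>a i = q (n+1) i\<close> for \<open>1 \<le> i \<le> k\<close>, \<open>a (k+1) = q (n+2) 1\<close>, and
  measure logarithms in units of \<open>ln (a k)\<close>; then \<open>a i\<close> has size \<open>\<eta> 1 + \<dots> + \<eta> i\<close> and \<open>a 0\<close> is negligible.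
  Lower bounds: \<open>x = a i\<close> yields an integer point with error of order \<open>a i / a (i+1)\<close>, and these \<open>k + 1\<close>
  points are independent.
  Upper bounds: let \<open>|x| \<le> X\<close> with \<open>a m \<le> X < a (m+1)\<close> and all errors below \<open>a (s-1) / a s\<close>. After
  multiplying the point by \<open>a 0\<close>, the first \<open>s\<close> coordinates force \<open>a 1, \<dots>, a s\<close> to divide \<open>x\<close>
  successively, so that \<open>y 1, \<dots>, y s\<close> are fixed multiples of \<open>x\<close>; since \<open>x\<close> is small,
  \<open>y (m+1), \<dots>, y k\<close> are fixed multiples of \<open>x\<close> as well. Hence such points span a space of dimension at
  most \<open>1 + m - s\<close>.
\<close>

section \<open>Linear independence and the functions \<open>omega_X\<close>\<close>


text \<open>Gaussian elimination by induction on the equations: if equation \<open>f\<close> is not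
  void, a pivot \<open>p\<close> with \<open>w p f \<noteq> 0\<close> eliminates the unknown
  \<open>c p\<close>, which leaves one equation and one unknown fewer.\<close>

lemma underdetermined_system_nontrivial:
  fixes w :: "'l \<Rightarrow> 'i \<Rightarrow> real"
  assumes "finite F" "finite J" "card F < card J"
  shows "\<exists>c. (\<exists>l\<in>J. c l \<noteq> 0) \<and> (\<forall>i\<in>F. (\<Sum>l\<in>J. c l * w l i) = 0)"
  using assms
proof (induction F arbitrary: J w rule: finite_induct)
  case empty
  then have "J \<noteq> {}" by auto
  then show ?case by (intro exI[of _ "\<lambda>_. 1"]) auto
next
  case (insert f F)
  show ?case
  proof (cases "\<forall>l\<in>J. w l f = 0")
    case True
    obtain c where "\<exists>l\<in>J. c l \<noteq> 0" "\<forall>i\<in>F. (\<Sum>l\<in>J. c l * w l i) = 0"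
      using insert.IH[of J w] insert.hyps insert.prems by auto
    then show ?thesis using True by (intro exI[of _ c]) auto
  next
    case False
    then obtain p where p: "p \<in> J" "w p f \<noteq> 0" by blast
    define J' where "J' = J - {p}"
    have J: "J = insert p J'" "p \<notin> J'" "finite J'" using p insert.prems J'_def by auto
    have "card F < card J'" using insert.prems insert.hyps J by simp
    then obtain c where c: "\<exists>l\<in>J'. c l \<noteq> 0"
      "\<forall>i\<in>F. (\<Sum>l\<in>J'. c l * (w l i - w l f / w p f * w p i)) = 0"
      using insert.IH[of J' "\<lambda>l i. w l i - w l f / w p f * w p i"] J by blast
    \<comment> \<open>The value at the pivot is the one that makes equation \<open>f\<close>
      hold.\<close>
    define d where "d = c(p := - (\<Sum>l\<in>J'. c l * w l f) / w p f)"
    have dJ': "(\<Sum>l\<in>J'. d l * g l) = (\<Sum>l\<in>J'. c l * g l)" for g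
      using J(2) by (intro sum.cong) (auto simp: d_def)
    have sum_d: "(\<Sum>l\<in>J. d l * w l i) = (\<Sum>l\<in>J'. c l * (w l i - w l f / w p f * w p i))" for i
    proof -
      have "(\<Sum>l\<in>J. d l * w l i) = d p * w p i + (\<Sum>l\<in>J'. c l * w l i)"
        using J dJ'[of "\<lambda>l. w l i"] by simp
      also have "d p * w p i = - (\<Sum>l\<in>J'. c l * (w l f / w p f * w p i))"
        by (simp add: d_def sum_distrib_right sum_divide_distrib mult.assoc)
      finally show ?thesis by (simp add: algebra_simps sum_subtractf)
    qed
    have "\<exists>l\<in>J. d l \<noteq> 0" using c(1) J by (auto simp: d_def)
    moreover have "(\<Sum>l\<in>J. d l * w l i) = 0" if "i \<in> insert f F" for i
    proof (cases "i = f")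
      case True
      then show ?thesis unfolding sum_d using p(2) by simp
    next
      case False
      then show ?thesis unfolding sum_d using that c(2) by simp
    qed
    ultimately show ?thesis by blast
  qed
qed

text \<open>Stands in for a dimension count: by \<open>det\<close>, a combination of the vectors
  that vanishes on the coordinates in \<open>F\<close> vanishes altogether, so more than
  \<open>card F\<close> vectors would satisfy a nontrivial relation.\<close>

lemma lin_indep_fam_card_le:
  assumes indep: "lin_indep_fam k j v" and "finite F"
    and det: "\<And>c i. i \<le> k \<Longrightarrow> (\<And>f. f \<in> F \<Longrightarrow> (\<Sum>l<j. c l * real_of_int (v l f)) = 0)
       \<Longrightarrow> (\<Sum>l<j. c l * real_of_int (v l i)) = 0"
  shows "j \<le> card F"
proof (rule ccontr)
  assume "\<not> j \<le> card F"
  then obtain c where c: "\<exists>l\<in>{..<j}. c l \<noteq> 0"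
    "\<forall>i\<in>F. (\<Sum>l<j. c l * real_of_int (v l i)) = 0"
    using underdetermined_system_nontrivial[of F "{..<j}" "\<lambda>l i. real_of_int (v l i)"] \<open>finite F\<close>
    by auto
  then have "\<forall>i\<le>k. (\<Sum>l<j. c l * real_of_int (v l i)) = 0" using det by blast
  then have "\<forall>l<j. c l = 0" using indep unfolding lin_indep_fam_def by blast
  with c(1) show False by auto
qed

lemma Ints_abs_less_1_eq_0:
  fixes z :: real
  assumes "z \<in> \<int>" "\<bar>z\<bar> < 1"
  shows "z = 0"
  using assms by (auto elim!: Ints_cases)

section \<open>Bounding \<open>omega_X\<close> by exhibiting or excluding families of integer
  points\<close>

lemma omega_X_geI:
  assumes "lin_indep_fam k j v"
    and "\<And>l. l < j \<Longrightarrow> \<bar>real_of_int (v l 0)\<bar> \<le> X"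
    and "\<And>l i. l < j \<Longrightarrow> 1 \<le> i \<Longrightarrow> i \<le> k \<Longrightarrow>
           \<bar>\<zeta> i * real_of_int (v l 0) - real_of_int (v l i)\<bar> \<le> X powr (-\<nu>)"
  shows "ereal \<nu> \<le> omega_X k \<zeta> j X"
  unfolding omega_X_def using assms by (intro Sup_upper) auto

text \<open>For \<open>X \<ge> 1\<close> the tolerance \<open>X powr (-\<nu>)\<close> decreases in
  \<open>\<nu>\<close>, so a family admissible for a larger exponent is admissible for
  \<open>\<nu>\<close>; it is enough to refute \<open>\<nu>\<close> itself.\<close>

lemma omega_X_leI:
  assumes "X \<ge> 1"
    and "\<And>v. lin_indep_fam k j v \<Longrightarrow> (\<And>l. l < j \<Longrightarrow> \<bar>real_of_int (v l 0)\<bar> \<le> X) \<Longrightarrow>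
      (\<And>l i. l < j \<Longrightarrow> 1 \<le> i \<Longrightarrow> i \<le> k \<Longrightarrow>
         \<bar>\<zeta> i * real_of_int (v l 0) - real_of_int (v l i)\<bar> \<le> X powr (-\<nu>)) \<Longrightarrow> False"
  shows "omega_X k \<zeta> j X \<le> ereal \<nu>"
  unfolding omega_X_def
proof (rule Sup_least, safe)
  fix \<mu> :: real and v :: "nat \<Rightarrow> nat \<Rightarrow> int"
  assume v: "lin_indep_fam k j v"
    "\<forall>l<j. \<bar>real_of_int (v l 0)\<bar> \<le> X \<and>
        (\<forall>i\<in>{1..k}. \<bar>\<zeta> i * of_int (v l 0) - of_int (v l i)\<bar> \<le> X powr (-\<mu>))"
  show "ereal \<mu> \<le> ereal \<nu>"
  proof (rule ccontr)
    assume "\<not> ereal \<mu> \<le> ereal \<nu>"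
    then have "X powr (-\<mu>) \<le> X powr (-\<nu>)" using \<open>X \<ge> 1\<close> by (intro powr_mono) auto
    then have "\<bar>\<zeta> i * real_of_int (v l 0) - real_of_int (v l i)\<bar> \<le> X powr (-\<nu>)"
      if "l < j" "1 \<le> i" "i \<le> k" for l i
      using v(2) that order_trans by (metis atLeastAtMost_iff)
    then show False using v(2) by (intro assms(2)[OF v(1)]) simp_all
  qed
qed

lemma omega_X_nonneg:
  assumes "X \<ge> 1" "j \<le> k + 1"
  shows "0 \<le> omega_X k \<zeta> j X"
proof -
  \<comment> \<open>Exponent 0 tolerates errors up to 1, so one rounded point with
    \<open>x = 1\<close>, completed by unit vectors with \<open>x = 0\<close>, is
    admissible.\<close>
  define v :: "nat \<Rightarrow> nat \<Rightarrow> int" where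
    "v l i = (if l = 0 then if i = 0 then 1 else \<lfloor>\<zeta> i\<rfloor> else if i = l then 1 else 0)" for l i
  have "lin_indep_fam k j v"
    unfolding lin_indep_fam_def
  proof (intro allI impI)
    fix c :: "nat \<Rightarrow> real" and l
    assume c: "\<forall>i\<le>k. (\<Sum>l<j. c l * of_int (v l i)) = 0" and "l < j"
    have "(\<Sum>l<j. c l * of_int (v l 0)) = (\<Sum>l<j. if l = 0 then c l else 0)"
      by (intro sum.cong) (auto simp: v_def)
    also have "\<dots> = c 0" using \<open>l < j\<close> by (subst sum.delta) auto
    finally have c0: "c 0 = 0" using c by auto
    have "(\<Sum>l'<j. c l' * of_int (v l' l)) = (\<Sum>l'<j. if l' = l then c l' else 0)"
      using c0 by (intro sum.cong) (auto simp: v_def)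
    also have "\<dots> = c l" using \<open>l < j\<close> by (subst sum.delta) auto
    finally show "c l = 0" using c \<open>l < j\<close> assms by auto
  qed
  then have "ereal 0 \<le> omega_X k \<zeta> j X"
  proof (rule omega_X_geI)
    fix l i :: nat
    assume "1 \<le> i"
    then have "\<bar>\<zeta> i * real_of_int (v l 0) - real_of_int (v l i)\<bar> \<le> 1"
      unfolding v_def by (auto; linarith)
    then show "\<bar>\<zeta> i * real_of_int (v l 0) - real_of_int (v l i)\<bar> \<le> X powr (-0)"
      using assms by simp
  qed (use assms in \<open>auto simp: v_def\<close>)
  then show ?thesis by (simp add: zero_ereal_def)
qed

section \<open>One block of denominators\<close>

text \<open>\<open>A i\<close> is the part of the series for \<open>\<zeta> i\<close> preceding the block; \<open>a 0\<close> clears its denominators.\<close>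
locale divisor_chain_block =
  fixes k :: nat and a :: "nat \<Rightarrow> nat" and A \<zeta> :: "nat \<Rightarrow> real"
  assumes a0_pos: "a 0 > 0"
    and a_dvd_Suc: "i < k \<Longrightarrow> a i dvd a (Suc i)"
    and a_less_Suc: "i \<le> k \<Longrightarrow> a i < a (Suc i)"
    and A_int: "1 \<le> i \<Longrightarrow> i \<le> k \<Longrightarrow> real (a 0) * A i \<in> \<int>"
    and zeta_ge: "1 \<le> i \<Longrightarrow> i \<le> k \<Longrightarrow> A i + 1 / real (a i) \<le> \<zeta> i"
    and zeta_le: "1 \<le> i \<Longrightarrow> i \<le> k \<Longrightarrow> \<zeta> i \<le> A i + 1 / real (a i) + 2 / real (a (Suc k))"
    and zeta_le': "1 \<le> i \<Longrightarrow> i \<le> k \<Longrightarrow> \<zeta> i \<le> A i + 2 / real (a i)"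
begin

lemma a_mono: "i \<le> i' \<Longrightarrow> i' \<le> Suc k \<Longrightarrow> a i \<le> a i'"
proof (induction i' rule: nat_induct_at_least[of i])
  case (Suc n)
  then show ?case using a_less_Suc[of n] by simp
qed auto

lemma a_pos: "i \<le> Suc k \<Longrightarrow> a i > 0"
  using a_mono[of 0 i] a0_pos by simp

lemma a_dvd: "i \<le> i' \<Longrightarrow> i' \<le> k \<Longrightarrow> a i dvd a i'"
proof (induction i' rule: nat_induct_at_least[of i])
  case (Suc n)
  then show ?case using a_dvd_Suc[of n] by (auto intro: dvd_trans)
qed auto

text \<open>Induction on \<open>i\<close>: once \<open>a (i - 1)\<close> divides
  \<open>a 0 * x\<close>, the quantity \<open>a 0 * ((A i + 1 / a i) * x - y i)\<close> has
  denominator \<open>g = a i / a (i - 1)\<close>. By \<open>small\<close> it is below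
  \<open>1 / g\<close> in size, hence zero, which gives the value of \<open>y i\<close> and the next
  divisibility at once. The two terms in \<open>small\<close> are the given error
  \<open>\<delta>\<close> and the part of \<open>\<zeta> i\<close> beyond the block.\<close>

lemma low_coordinate:
  fixes x :: int and y :: "nat \<Rightarrow> int" and X \<delta> :: real
  assumes x: "\<bar>real_of_int x\<bar> \<le> X"
    and y: "\<And>i. 1 \<le> i \<Longrightarrow> i \<le> k \<Longrightarrow> \<bar>\<zeta> i * real_of_int x - real_of_int (y i)\<bar> \<le> \<delta>"
    and small: "\<And>i. 1 \<le> i \<Longrightarrow> i \<le> s \<Longrightarrow>
      a 0 * \<delta> + 2 * a 0 * X / a (Suc k) < a (i - 1) / a i"
    and "i \<le> s" "s \<le> k"
  shows "int (a i) dvd int (a 0) * x \<and>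
    (1 \<le> i \<longrightarrow> real_of_int (y i) = (A i + 1 / a i) * real_of_int x)"
  using \<open>i \<le> s\<close>
proof (induction i)
  case 0
  then show ?case by simp
next
  case (Suc h)
  let ?i = "Suc h"
  have i: "1 \<le> ?i" "?i \<le> k" "h < k" using Suc.prems \<open>s \<le> k\<close> by auto
  obtain w where w: "int (a 0) * x = int (a h) * w" using Suc by (auto elim: dvdE)
  obtain g where g: "a ?i = a h * g" using a_dvd_Suc[OF i(3)] by (auto elim: dvdE)
  have pos: "a h > 0" "a ?i > 0" "a (Suc k) > 0" using a_pos i by auto
  then have gpos: "g > 0" using g by (metis gr0I mult_0_right)
  obtain N where N: "real (a 0) * A ?i = real_of_int N"
    using A_int[OF i(1,2)] by (auto elim: Ints_cases)
  define B where "B = N * x - int (a 0) * y ?i"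
  have w': "real (a 0) * real_of_int x = real (a h) * real_of_int w"
    using w by (metis of_int_mult of_int_of_nat_eq)
  have expand: "a 0 * ((A ?i + 1 / a ?i) * real_of_int x - y ?i) = B + w / g"
  proof -
    have "a 0 * ((A ?i + 1 / a ?i) * real_of_int x - y ?i)
        = (a 0 * A ?i) * x - a 0 * y ?i + (a 0 * real_of_int x) / a ?i"
      by (simp add: algebra_simps)
    also have "(a 0 * real_of_int x) / a ?i = w / g"
      unfolding w' using pos gpos by (simp add: g)
    finally show ?thesis unfolding N B_def by simp
  qed
  \<comment> \<open>Cutting \<open>\<zeta>\<close> after its term in the block changes the product
    with \<open>x\<close> by at most \<open>2 * X / a (Suc k)\<close>.\<close>
  have "\<bar>(A ?i + 1 / a ?i) * real_of_int x - y ?i\<bar> \<le> \<delta> + 2 * X / a (Suc k)"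
  proof -
    have "\<bar>\<zeta> ?i - (A ?i + 1 / a ?i)\<bar> * \<bar>real_of_int x\<bar> \<le> 2 / a (Suc k) * X"
      using zeta_ge[OF i(1,2)] zeta_le[OF i(1,2)] x by (intro mult_mono) auto
    then have "\<bar>(\<zeta> ?i - (A ?i + 1 / a ?i)) * real_of_int x\<bar> \<le> 2 * X / a (Suc k)"
      by (simp add: abs_mult)
    moreover have "(\<zeta> ?i - (A ?i + 1 / a ?i)) * real_of_int x
      = (\<zeta> ?i * x - y ?i) - ((A ?i + 1 / a ?i) * x - y ?i)" by (simp add: algebra_simps)
    ultimately show ?thesis using y[OF i(1,2)] by linarith
  qed
  then have "\<bar>a 0 * ((A ?i + 1 / a ?i) * real_of_int x - y ?i)\<bar> \<le> a 0 * (\<delta> + 2 * X / a (Suc k))"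
    unfolding abs_mult by (simp add: mult_left_mono)
  also have "\<dots> < a h / a ?i" using small[of ?i] Suc.prems by (simp add: algebra_simps)
  also have "\<dots> = 1 / g" using g pos by simp
  \<comment> \<open>Multiplied by \<open>g\<close>, the sum becomes the integer
    \<open>B * g + w\<close>, which is therefore zero.\<close>
  finally have "\<bar>B + w / g\<bar> * g < 1" unfolding expand using gpos by (simp add: field_simps)
  moreover have "(B + w / g) * g = real_of_int (B * g + w)" using gpos by (simp add: field_simps)
  then have "\<bar>B + w / g\<bar> * g = \<bar>real_of_int (B * g + w)\<bar>" by (metis abs_mult abs_of_nat)
  ultimately have "\<bar>real_of_int (B * g + w)\<bar> < 1" by linarith
  then have Bg: "B * g + w = 0" by linarith
  then have "(B + w / g) * g = 0" using \<open>(B + w / g) * g = real_of_int (B * g + w)\<close> by simp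
  then have "B + w / g = 0" using gpos by simp
  then have "real_of_int (y ?i) = (A ?i + 1 / a ?i) * real_of_int x"
    using expand a0_pos by simp
  moreover have "w = - B * g" using Bg by simp
  then have "int (a 0) * x = int (a ?i) * (- B)" using w g by simp
  then have "int (a ?i) dvd int (a 0) * x" by (metis dvd_triv_left)
  ultimately show ?case by simp
qed

text \<open>For \<open>i > m\<close> even the term \<open>1 / a i\<close> is too small to be felt by
  \<open>x\<close>: \<open>\<zeta> i\<close> lies within \<open>2 / a (Suc m)\<close> of
  \<open>A i\<close>, and \<open>a 0 * (A i * x - y i)\<close> is an integer of size below
  1.\<close>

lemma high_coordinate:
  fixes x :: int and y :: "nat \<Rightarrow> int" and X \<delta> :: real
  assumes x: "\<bar>real_of_int x\<bar> \<le> X"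
    and y: "\<And>i. 1 \<le> i \<Longrightarrow> i \<le> k \<Longrightarrow> \<bar>\<zeta> i * real_of_int x - real_of_int (y i)\<bar> \<le> \<delta>"
    and small: "a 0 * \<delta> + 2 * a 0 * X / a (Suc m) < 1"
    and i: "m < i" "i \<le> k"
  shows "real_of_int (y i) = A i * real_of_int x"
proof -
  have i': "1 \<le> i" "i \<le> k" using i by auto
  have "real (a 0) * (A i * x - y i) \<in> \<int>"
    using Ints_diff[OF Ints_mult[OF A_int[OF i'] Ints_of_int[of x]] Ints_of_int[of "int (a 0) * y i"]]
    by (simp add: algebra_simps)
  moreover have "\<bar>real (a 0) * (A i * x - y i)\<bar> < 1"
  proof -
    have pos: "a i > 0" "a (Suc m) > 0" using a_pos i by auto
    have "2 / real (a i) \<le> 2 / a (Suc m)" using a_mono[of "Suc m" i] i pos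
      by (intro divide_left_mono) auto
    moreover have "0 \<le> 1 / real (a i)" by simp
    ultimately have "\<bar>\<zeta> i - A i\<bar> \<le> 2 / a (Suc m)"
      using zeta_ge[OF i'] zeta_le'[OF i'] by linarith
    then have "\<bar>\<zeta> i - A i\<bar> * \<bar>real_of_int x\<bar> \<le> 2 / a (Suc m) * X"
      using x by (intro mult_mono) auto
    then have "\<bar>(\<zeta> i - A i) * real_of_int x\<bar> \<le> 2 * X / a (Suc m)" by (simp add: abs_mult)
    moreover have "(\<zeta> i - A i) * real_of_int x = (\<zeta> i * x - y i) - (A i * x - y i)"
      by (simp add: algebra_simps)
    ultimately have "\<bar>A i * real_of_int x - y i\<bar> \<le> \<delta> + 2 * X / a (Suc m)"
      using y[OF i'] by linarith
    then have "\<bar>real (a 0) * (A i * x - y i)\<bar> \<le> a 0 * (\<delta> + 2 * X / a (Suc m))"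
      unfolding abs_mult by (simp add: mult_left_mono)
    then show ?thesis using small by (simp add: algebra_simps)
  qed
  ultimately have "real (a 0) * (A i * x - y i) = 0" by (rule Ints_abs_less_1_eq_0)
  then show ?thesis using a0_pos by simp
qed

text \<open>Coordinates \<open>1..s\<close> are low and those beyond \<open>m\<close> are high, so
  all of these are fixed multiples of \<open>x\<close>. Only \<open>Suc m - s\<close> coordinates
  remain free, fewer than \<open>j\<close>.\<close>

lemma omega_X_le_block:
  fixes X \<nu> :: real
  assumes "X \<ge> 1" and m: "m \<le> k" and s: "s \<le> Suc m" "s \<le> k" and j: "Suc m - s < j"
    and low: "\<And>i. 1 \<le> i \<Longrightarrow> i \<le> s \<Longrightarrow>
      a 0 * X powr (-\<nu>) + 2 * a 0 * X / a (Suc k) < a (i - 1) / a i"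
    and high: "m < k \<Longrightarrow> a 0 * X powr (-\<nu>) + 2 * a 0 * X / a (Suc m) < 1"
  shows "omega_X k \<zeta> j X \<le> ereal \<nu>"
proof (rule omega_X_leI[OF \<open>X \<ge> 1\<close>])
  fix v :: "nat \<Rightarrow> nat \<Rightarrow> int"
  assume v: "lin_indep_fam k j v"
    and vX: "\<And>l. l < j \<Longrightarrow> \<bar>real_of_int (v l 0)\<bar> \<le> X"
    and vd: "\<And>l i. l < j \<Longrightarrow> 1 \<le> i \<Longrightarrow> i \<le> k \<Longrightarrow>
         \<bar>\<zeta> i * real_of_int (v l 0) - real_of_int (v l i)\<bar> \<le> X powr (-\<nu>)"
  \<comment> \<open>The free coordinates; for \<open>s = Suc m\<close> not even \<open>x\<close> is
    free.\<close>
  define F where "F = (if s = Suc m then {} else insert 0 {Suc s..m})"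
  have cF: "card F = Suc m - s" using s by (auto simp: F_def)
  have lo: "real_of_int (v l i) = (A i + 1 / a i) * v l 0" if "l < j" "1 \<le> i" "i \<le> s" for l i
    using low_coordinate[OF vX[OF that(1)] vd[OF that(1)] low that(3) s(2)] that(2) by blast
  have hi: "real_of_int (v l i) = A i * v l 0" if "l < j" "m < i" "i \<le> k" for l i
    using high_coordinate[OF vX[OF that(1)] vd[OF that(1)] high that(2,3)] that(2,3) by auto
  have "j \<le> card F"
  proof (rule lin_indep_fam_card_le[OF v])
    show "finite F" by (simp add: F_def)
    fix c :: "nat \<Rightarrow> real" and i
    assume i: "i \<le> k" and F0: "\<And>f. f \<in> F \<Longrightarrow> (\<Sum>l<j. c l * real_of_int (v l f)) = 0"
    have x0: "(\<Sum>l<j. c l * real_of_int (v l 0)) = 0"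
    proof (cases "s = Suc m")
      case True
      \<comment> \<open>Coordinate \<open>s\<close> is now both low and high, and the two factors
        differ by \<open>1 / a s\<close>, which forces \<open>x = 0\<close>.\<close>
      have "v l 0 = 0" if "l < j" for l
      proof -
        have "(A s + 1 / a s) * v l 0 = A s * v l 0" using lo[OF that, of s] hi[OF that, of s] True s by simp
        moreover have "a s > 0" using a_pos s by simp
        ultimately show ?thesis by (simp add: distrib_right)
      qed
      then show ?thesis by simp
    next
      case False
      then show ?thesis using F0[of 0] by (simp add: F_def)
    qed
    have lin: "(\<Sum>l<j. c l * real_of_int (v l i)) = 0"
      if "\<And>l. l < j \<Longrightarrow> real_of_int (v l i) = t * v l 0" for t :: real
    proof -
      have "(\<Sum>l<j. c l * real_of_int (v l i)) = (\<Sum>l<j. t * (c l * real_of_int (v l 0)))"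
        using that by (intro sum.cong) auto
      then show ?thesis using x0 by (simp add: sum_distrib_left[symmetric])
    qed
    consider "i = 0" | "1 \<le> i" "i \<le> s" | "m < i" | "s < i" "i \<le> m" by linarith
    then show "(\<Sum>l<j. c l * real_of_int (v l i)) = 0"
    proof cases
      case 1
      then show ?thesis using x0 by simp
    next
      case 2
      then show ?thesis by (intro lin[of "A i + 1 / real (a i)"] lo)
    next
      case 3
      then show ?thesis using i by (intro lin[of "A i"] hi)
    next
      case 4
      then show ?thesis using F0[of i] by (simp add: F_def)
    qed
  qed
  with cF j show False by simp
qed

text \<open>The points are those with \<open>x = a i\<close> for \<open>p \<le> i < p + j\<close>,
  where \<open>y l\<close> comes from the partial sum of \<open>\<zeta> l\<close> whose denominators
  divide \<open>a i\<close>. The omitted part is at most \<open>2 / a (Suc i)\<close>, so the error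
  is at most \<open>2 * a i / a (Suc i)\<close>.\<close>

lemma omega_X_ge_block:
  fixes X \<nu> :: real
  assumes p: "p + j \<le> Suc k" "j \<ge> 1" and X: "a (p + j - 1) \<le> X"
    and small: "\<And>i. p \<le> i \<Longrightarrow> i < p + j \<Longrightarrow> 2 * a i / a (Suc i) \<le> X powr (-\<nu>)"
  shows "ereal \<nu> \<le> omega_X k \<zeta> j X"
proof -
  define Y where "Y i l = real (a i) * (A l + (if l \<le> i then 1 / a l else 0))" for i l
  have Y_int: "Y i l \<in> \<int>" if il: "i \<le> k" "1 \<le> l" "l \<le> k" for i l
  proof -
    obtain g where g: "a i = a 0 * g" using a_dvd[of 0 i] il by (auto elim: dvdE)
    have "real (a i) * A l = real g * (a 0 * A l)" by (simp add: g)
    then have "real (a i) * A l \<in> \<int>" using A_int[OF il(2,3)] by (metis Ints_mult Ints_of_nat)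
    moreover have "real (a i) * (if l \<le> i then 1 / a l else 0) \<in> \<int>"
    proof (cases "l \<le> i")
      case True
      obtain h where h: "a i = a l * h" using a_dvd[of l i] True il by (auto elim: dvdE)
      have "a l > 0" using a_pos il by simp
      then have "real (a i) * (1 / a l) = real h" by (simp add: h)
      then show ?thesis using True by simp
    qed simp
    ultimately show ?thesis unfolding Y_def distrib_left by (rule Ints_add)
  qed
  \<comment> \<open>The floor only changes the type: for \<open>l < j\<close> and
    \<open>1 \<le> i \<le> k\<close> the number \<open>Y (p + l) i\<close> is an integer.\<close>
  define v :: "nat \<Rightarrow> nat \<Rightarrow> int" where
    "v l i = (if i = 0 then int (a (p + l)) else \<lfloor>Y (p + l) i\<rfloor>)" for l i
  have v0: "real_of_int (v l 0) = a (p + l)" for l by (simp add: v_def)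
  have vi: "real_of_int (v l i) = Y (p + l) i" if "l < j" "1 \<le> i" "i \<le> k" for l i
  proof -
    have "Y (p + l) i \<in> \<int>" using Y_int that p by simp
    then show ?thesis using that by (auto simp: v_def elim!: Ints_cases)
  qed
  have "lin_indep_fam k j v"
    unfolding lin_indep_fam_def
  proof (intro allI impI)
    fix c :: "nat \<Rightarrow> real" and l
    assume c: "\<forall>i\<le>k. (\<Sum>l<j. c l * of_int (v l i)) = 0" and "l < j"
    define d where "d l = c l * a (p + l)" for l
    have "(\<Sum>l<j. c l * of_int (v l 0)) = 0" using c by simp
    then have d0: "(\<Sum>l<j. d l) = 0" unfolding v0 d_def .
    \<comment> \<open>Subtracting \<open>A i\<close> times coordinate 0 from coordinate \<open>i\<close> makes the family triangular.\<close>
    have tri: "(\<Sum>l<j. if i \<le> p + l then d l else 0) = 0" if i: "1 \<le> i" "i \<le> k" for i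
    proof -
      have "0 = (\<Sum>l<j. c l * of_int (v l i))" using c i by simp
      also have "\<dots> = (\<Sum>l<j. c l * Y (p + l) i)" using vi i by (intro sum.cong) auto
      also have "\<dots> = (\<Sum>l<j. A i * d l + (if i \<le> p + l then d l else 0) / a i)"
        unfolding Y_def d_def by (intro sum.cong) (auto simp: algebra_simps)
      also have "\<dots> = A i * (\<Sum>l<j. d l) + (\<Sum>l<j. if i \<le> p + l then d l else 0) / a i"
        by (simp add: sum.distrib sum_distrib_left sum_divide_distrib)
      finally show ?thesis using d0 a_pos[of i] i by simp
    qed
    \<comment> \<open>\<open>t = 0\<close> comes from coordinate 0, \<open>t = j\<close> is an empty
      sum, and otherwise coordinate \<open>p + t\<close> is used. Differences of consecutive tails
      isolate \<open>d l\<close>.\<close>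
    have tail: "(\<Sum>l<j. if t \<le> l then d l else 0) = 0" if t: "t \<le> j" for t
    proof -
      consider "t = 0" | "t = j" | "1 \<le> t" "t < j" using t by fastforce
      then show ?thesis
      proof cases
        case 3
        then show ?thesis using tri[of "p + t"] p by simp
      qed (use d0 in \<open>auto intro: sum.neutral\<close>)
    qed
    have "d l = (\<Sum>l'<j. if l' = l then d l' else 0)" using \<open>l < j\<close> by (subst sum.delta) auto
    also have "\<dots> = (\<Sum>l'<j. (if l \<le> l' then d l' else 0) - (if Suc l \<le> l' then d l' else 0))"
      by (intro sum.cong) auto
    also have "\<dots> = 0" using tail[of l] tail[of "Suc l"] \<open>l < j\<close> by (simp add: sum_subtractf)
    finally have "d l = 0" .
    moreover have "a (p + l) > 0" using a_pos p \<open>l < j\<close> by simp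
    ultimately show "c l = 0" by (simp add: d_def)
  qed
  then show ?thesis
  proof (rule omega_X_geI)
    fix l assume "l < j"
    then have "a (p + l) \<le> a (p + j - 1)" using p by (intro a_mono) auto
    then show "\<bar>real_of_int (v l 0)\<bar> \<le> X" using X unfolding v0 by linarith
  next
    fix l i assume li: "l < j" "1 \<le> i" "i \<le> k"
    let ?r = "p + l"
    have r: "?r \<le> k" using li p by simp
    have pos: "a ?r > 0" "a (Suc ?r) > 0" "a i > 0" "a (Suc k) > 0" using a_pos r li by auto
    let ?t = "\<zeta> i - (A i + (if i \<le> ?r then 1 / a i else 0))"
    have t0: "0 \<le> ?t" using zeta_ge[OF li(2,3)] by (auto intro: order_trans[of _ "A i + 1 / a i"])
    \<comment> \<open>If \<open>i \<le> ?r\<close>, what is missing starts after the block;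
      otherwise it starts with \<open>1 / a i\<close>, where \<open>i \<ge> Suc ?r\<close>.\<close>
    have t1: "?t \<le> 2 / a (Suc ?r)"
    proof (cases "i \<le> ?r")
      case True
      have "2 / real (a (Suc k)) \<le> 2 / a (Suc ?r)"
        using a_mono[of "Suc ?r" "Suc k"] r pos by (intro divide_left_mono) auto
      then show ?thesis using zeta_le[OF li(2,3)] True by simp
    next
      case False
      then have "2 / real (a i) \<le> 2 / a (Suc ?r)"
        using a_mono[of "Suc ?r" i] li pos by (intro divide_left_mono) auto
      then show ?thesis using zeta_le'[OF li(2,3)] False by simp
    qed
    have "\<zeta> i * real_of_int (v l 0) - real_of_int (v l i) = a ?r * ?t"
      unfolding v0 vi[OF li] Y_def by (simp add: algebra_simps)
    then have "\<bar>\<zeta> i * real_of_int (v l 0) - real_of_int (v l i)\<bar> = a ?r * ?t" using t0 by (simp add: abs_mult)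
    also have "\<dots> \<le> a ?r * (2 / a (Suc ?r))" using t1 by (intro mult_left_mono) auto
    also have "\<dots> \<le> X powr (-\<nu>)" using small[of ?r] li by (simp add: mult.commute)
    finally show "\<bar>\<zeta> i * real_of_int (v l 0) - real_of_int (v l i)\<bar> \<le> X powr (-\<nu>)" .
  qed
qed

end

section \<open>Logarithmic estimates\<close>

lemma mult_powr_minus_le:
  fixes c d X \<nu> :: real
  assumes "c > 0" "d > 0" "X > 0" "ln c - \<nu> * ln X \<le> ln d"
  shows "c * X powr (-\<nu>) \<le> d"
proof -
  have "ln (c * X powr (-\<nu>)) \<le> ln d" using assms by (simp add: ln_mult ln_powr)
  then show ?thesis using assms by (subst (asm) ln_le_cancel_iff) auto
qed

locale gap_weights =
  fixes k :: nat and \<eta> :: "nat \<Rightarrow> real"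
  assumes k_pos: "k \<ge> 1"
    and eta_1_pos: "\<eta> 1 > 0"
    and eta_step: "2 \<le> i \<Longrightarrow> i \<le> k \<Longrightarrow> \<eta> (i - 1) \<le> \<eta> i"
    and eta_sum: "(\<Sum>i=1..k. \<eta> i) = 1"
begin

lemma eta_mono: "i \<le> i' \<Longrightarrow> 1 \<le> i \<Longrightarrow> i' \<le> k \<Longrightarrow> \<eta> i \<le> \<eta> i'"
proof (induction i' rule: nat_induct_at_least[of i])
  case (Suc n)
  then show ?case using eta_step[of "Suc n"] by simp
qed auto

lemma eta_pos: "1 \<le> i \<Longrightarrow> i \<le> k \<Longrightarrow> \<eta> i > 0"
  using eta_mono[of 1 i] eta_1_pos by simp

definition S :: "nat \<Rightarrow> real" where "S m = (\<Sum>i=1..m. \<eta> i)"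

lemma eta_le_S:
  assumes "1 \<le> i" "i \<le> m" "m \<le> k"
  shows "\<eta> i \<le> S m"
  unfolding S_def using assms eta_pos by (intro member_le_sum) (auto intro: less_imp_le)

lemma S_pos: "1 \<le> m \<Longrightarrow> m \<le> k \<Longrightarrow> 0 < S m"
  using eta_le_S[of 1 m] eta_1_pos by simp

lemma S_le_1:
  assumes "m \<le> k"
  shows "S m \<le> 1"
proof -
  have "S m \<le> (\<Sum>i=1..k. \<eta> i)"
    unfolding S_def using assms eta_pos by (intro sum_mono2) (auto intro: less_imp_le)
  then show ?thesis using eta_sum by simp
qed

end

text \<open>The limit hypotheses at a finite stage: logarithms in units of \<open>L\<close>, with
  relative tolerance \<open>e\<close>. The 8 in \<open>ln_a0\<close> absorbs the numerical constants
  met below; \<open>e \<le> 1 / 8\<close> turns \<open>ln_top\<close> into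
  \<open>8 * L \<le> ln (a (Suc k))\<close>.\<close>

locale controlled_block = divisor_chain_block k a A \<zeta> + gap_weights k \<eta>
  for k :: nat and a :: "nat \<Rightarrow> nat" and A \<zeta> \<eta> :: "nat \<Rightarrow> real" +
  fixes e L :: real
  assumes e_pos: "0 < e" and e_le: "e \<le> 1 / 8" and L_pos: "0 < L"
    and ln_a0: "ln (8 * real (a 0)) \<le> e * L"
    and ln_gap: "1 \<le> i \<Longrightarrow> i \<le> k \<Longrightarrow>
      \<bar>ln (real (a i)) - ln (real (a (i - 1))) - \<eta> i * L\<bar> \<le> e * L"
    and ln_level: "1 \<le> i \<Longrightarrow> i \<le> k \<Longrightarrow> \<bar>ln (real (a i)) - S i * L\<bar> \<le> e * L"
    and ln_top: "L / e \<le> ln (real (a (Suc k)))"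
begin

lemma ln_8: "ln 8 + ln (real (a 0)) \<le> e * L"
  using ln_a0 a0_pos by (simp add: ln_mult)

lemma ln_mult_a0_le:
  assumes "0 < c" "c \<le> 8"
  shows "ln (c * real (a 0)) \<le> e * L"
proof -
  have "ln (c * real (a 0)) \<le> ln (8 * real (a 0))"
    using assms a0_pos by (subst ln_le_cancel_iff) auto
  then show ?thesis using ln_a0 by simp
qed

lemma ln_a0_nonneg: "0 \<le> ln (real (a 0))"
  using a0_pos by (simp add: Suc_leI)

lemma ln_top_ge: "8 * L \<le> ln (real (a (Suc k)))"
proof -
  have "8 * L \<le> L / e" using e_pos e_le L_pos by (simp add: field_simps)
  then show ?thesis using ln_top by simp
qed

text \<open>As \<open>\<eta>\<close> is monotone, the widest of the gaps \<open>1..s\<close> is, up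
  to the tolerance, the last one, so the conditions of \<open>omega_X_le_block\<close> for all
  \<open>i \<le> s\<close> reduce to one inequality on \<open>\<eta> s\<close>.\<close>

lemma omega_X_le_log:
  fixes X \<nu> :: real
  assumes X: "X \<ge> 1" "X\<^sup>2 \<le> a (Suc k)" and m: "m \<le> k" and s: "s \<le> Suc m" "s \<le> k"
    and j: "Suc m - s < j"
    and low: "1 \<le> s \<Longrightarrow> (\<eta> s + 2 * e) * L \<le> \<nu> * ln X"
    and high: "e * L \<le> \<nu> * ln X" "m < k \<Longrightarrow> 4 * a 0 * X < a (Suc m)"
  shows "omega_X k \<zeta> j X \<le> ereal \<nu>"
proof (rule omega_X_le_block[OF X(1) m s j])
  have ln4: "ln (4 * real (a 0)) \<le> e * L" "ln (8 * real (a 0)) \<le> e * L"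
    using ln_mult_a0_le by auto
  fix i assume i: "1 \<le> i" "i \<le> s"
  have pos: "a i > 0" "a (i - 1) > 0" "a (Suc k) > 0" using a_pos i s by auto
  define r where "r = real (a (i - 1)) / a i"
  have r: "r > 0" "ln r = ln (real (a (i - 1))) - ln (real (a i))"
    using pos by (auto simp: r_def ln_div)
  have "\<eta> i * L \<le> \<eta> s * L" using eta_mono[of i s] i s L_pos by simp
  then have lr: "- (\<eta> s + e) * L \<le> ln r"
    using ln_gap[of i] i s unfolding r by (simp add: algebra_simps abs_le_iff)
  \<comment> \<open>The constants 4 and 8 make each of the two error terms at most
    \<open>r / 4\<close>, so that their sum stays strictly below \<open>r\<close>.\<close>
  have "4 * a 0 * X powr (-\<nu>) \<le> r"
    using low i ln4 lr pos X a0_pos r by (intro mult_powr_minus_le) (auto simp: algebra_simps)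
  \<comment> \<open>\<open>X\<^sup>2 \<le> a (Suc k)\<close> bounds \<open>X / a (Suc k)\<close> by
    the inverse square root of \<open>a (Suc k)\<close>, hence by \<open>exp (- 4 * L)\<close>,
    whereas \<open>r\<close> is at least \<open>exp (- (1 + e) * L)\<close>.\<close>
  moreover have "8 * a 0 * X / a (Suc k) \<le> r"
  proof -
    have "ln (X\<^sup>2) \<le> ln (real (a (Suc k)))" using X pos by (subst ln_le_cancel_iff) auto
    then have "2 * ln X \<le> ln (real (a (Suc k)))" using X by (simp add: ln_realpow)
    moreover have "\<eta> s * L \<le> L" using eta_le_S[of s s] S_le_1[of s] i s L_pos by simp
    moreover have "e * L \<le> L" using e_le L_pos by simp
    ultimately have "ln (8 * real (a 0)) + ln X - ln (real (a (Suc k))) \<le> ln r"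
      using ln4(2) ln_top_ge lr L_pos unfolding minus_mult_left[symmetric] distrib_right by linarith
    then have "ln (8 * a 0 * X / a (Suc k)) \<le> ln r"
      using X a0_pos pos by (simp add: ln_mult ln_div)
    then show ?thesis using X a0_pos pos r by (subst (asm) ln_le_cancel_iff) auto
  qed
  ultimately have "a 0 * X powr (-\<nu>) + 2 * a 0 * X / a (Suc k) < r" using r(1) by simp
  then show "a 0 * X powr (-\<nu>) + 2 * a 0 * X / a (Suc k) < a (i - 1) / a i" by (simp add: r_def)
next
  assume "m < k"
  have "ln (4 * real (a 0)) \<le> e * L" using ln_mult_a0_le by auto
  then have "4 * a 0 * X powr (-\<nu>) \<le> 1"
    using high X a0_pos by (intro mult_powr_minus_le) auto
  moreover have "4 * a 0 * X / a (Suc m) < 1"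
    using high(2)[OF \<open>m < k\<close>] a_pos[of "Suc m"] m by simp
  ultimately show "a 0 * X powr (-\<nu>) + 2 * a 0 * X / a (Suc m) < 1" by simp
qed

text \<open>Monotonicity of \<open>\<eta>\<close> makes the narrowest gap used the first one, of
  size \<open>\<eta> (Suc p)\<close>. One \<open>e\<close> pays for \<open>ln_gap\<close>, the other
  for the factor 2 in the error.\<close>

lemma omega_X_ge_log:
  fixes X \<nu> :: real
  assumes p: "p + j \<le> Suc k" "j \<ge> 1" "p < k" and X: "a (p + j - 1) \<le> X"
    and \<nu>: "\<nu> * ln X \<le> (\<eta> (Suc p) - 2 * e) * L"
  shows "ereal \<nu> \<le> omega_X k \<zeta> j X"
proof (rule omega_X_ge_block[OF p(1,2) X])
  fix i assume i: "p \<le> i" "i < p + j"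
  have pos: "a i > 0" "a (Suc i) > 0" using a_pos i p by auto
  have "0 < real (a (p + j - 1))" using a_pos[of "p + j - 1"] p by simp
  then have "0 < X" using X by linarith
  have "ln 2 \<le> ln (2 * real (a 0))" using a0_pos by (subst ln_le_cancel_iff) auto
  then have ln2: "ln 2 \<le> e * L" using ln_mult_a0_le[of 2] by simp
  have "(\<eta> (Suc p) - e) * L \<le> ln (real (a (Suc i))) - ln (real (a i))"
  proof (cases "i = k")
    \<comment> \<open>The gap from \<open>a k\<close> to \<open>a (Suc k)\<close> is not governed by
      \<open>\<eta>\<close>, but \<open>ln_top_ge\<close> makes it wider than needed.\<close>
    case True
    have "\<eta> (Suc p) * L \<le> L" using eta_le_S[of "Suc p" "Suc p"] S_le_1[of "Suc p"] p L_pos by simp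
    moreover have "S k * L \<le> L" using S_le_1[of k] L_pos by simp
    moreover have "0 \<le> e * L" "e * L \<le> L" using e_pos e_le L_pos by auto
    moreover have "ln (real (a k)) \<le> S k * L + e * L" using ln_level[of k] k_pos by (simp add: abs_le_iff)
    ultimately show ?thesis using ln_top_ge L_pos unfolding True left_diff_distrib by linarith
  next
    case False
    then have "i < k" using i p by simp
    then have "\<eta> (Suc p) * L \<le> \<eta> (Suc i) * L" using eta_mono[of "Suc p" "Suc i"] i L_pos by simp
    then show ?thesis using ln_gap[of "Suc i"] \<open>i < k\<close> by (simp add: algebra_simps abs_le_iff)
  qed
  then have "ln (2 * real (a i) / a (Suc i)) + \<nu> * ln X \<le> 0"
    using \<nu> ln2 pos by (simp add: ln_mult ln_div algebra_simps)
  then have "2 * real (a i) / a (Suc i) * X powr (- (-\<nu>)) \<le> 1"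
    using pos \<open>0 < X\<close> by (intro mult_powr_minus_le) auto
  then show "real (2 * a i) / a (Suc i) \<le> X powr (-\<nu>)"
    using \<open>0 < X\<close> by (simp add: powr_minus field_simps)
qed

text \<open>With \<open>m\<close> the level of \<open>X\<close>, \<open>j\<close> independent points
  are excluded by \<open>s = m + 2 - j\<close> low coordinates; the exponent needed is about
  \<open>\<eta> s / S m\<close>, since \<open>ln X\<close> is at least about \<open>S m * L\<close>.
  The condition \<open>a 1 \<le> X\<^sup>2\<close> keeps \<open>ln X\<close> comparable to
  \<open>L\<close> also when \<open>s = 0\<close>.\<close>

lemma omega_X_le_of_ratio:
  fixes X M \<epsilon> :: real
  assumes j: "j \<ge> 2" and M: "M \<ge> 0" and "\<epsilon> > 0"
    and ratio: "\<And>m. j - 1 \<le> m \<Longrightarrow> m \<le> k \<Longrightarrow> \<eta> (m + 2 - j) \<le> M * S m"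
    and small: "e * (4 + 4 * M + 4 * \<epsilon>) \<le> \<epsilon> * \<eta> 1"
    and X: "X \<ge> 1" "a 1 \<le> X\<^sup>2" "X\<^sup>2 \<le> a (Suc k)"
  shows "omega_X k \<zeta> j X \<le> ereal (M + \<epsilon>)"
proof -
  \<comment> \<open>The factor \<open>4 * a 0\<close> is chosen so that maximality of
    \<open>m\<close> is the condition \<open>high\<close> of \<open>omega_X_le_log\<close>;
    admitting \<open>m = 0\<close> outright ensures that a greatest index exists.\<close>
  define P where "P m \<longleftrightarrow> m \<le> k \<and> (m = 0 \<or> a m \<le> 4 * a 0 * X)" for m
  define m where "m = Greatest P"
  have P0: "P 0" by (simp add: P_def)
  have Pb: "P m' \<Longrightarrow> m' \<le> k" for m' by (simp add: P_def)
  have Pm: "P m" unfolding m_def using P0 Pb by (rule GreatestI_nat)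
  have Pmax: "P m' \<Longrightarrow> m' \<le> m" for m' unfolding m_def by (rule Greatest_le_nat[OF _ Pb])
  have m: "m \<le> k" using Pm Pb by simp
  have next_large: "4 * a 0 * X < a (Suc m)" if "m < k"
    using Pmax[of "Suc m"] that unfolding P_def by linarith
  have eM: "0 \<le> e * M" "0 \<le> e * \<epsilon>" using e_pos M \<open>\<epsilon> > 0\<close> by auto
  have s1: "4 * e \<le> \<epsilon> * \<eta> 1" using small eM by (simp add: algebra_simps)
  have "e * \<epsilon> \<le> (\<eta> 1 / 4) * \<epsilon>" using small eM e_pos by (simp add: algebra_simps)
  then have s2: "e \<le> \<eta> 1 / 4" using \<open>\<epsilon> > 0\<close> mult_le_cancel_right_pos by blast
  have pos1: "0 < real (a 1)" using a_pos[of 1] k_pos by simp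
  have "ln (real (a 1)) \<le> ln (X\<^sup>2)" using X pos1 by (subst ln_le_cancel_iff) auto
  then have l1: "ln (real (a 1)) \<le> 2 * ln X" using X by (simp add: ln_realpow)
  have "(\<eta> 1 - e) * L \<le> ln (real (a 1))"
    using ln_level[of 1] k_pos by (simp add: S_def algebra_simps abs_le_iff)
  moreover have "(\<eta> 1 / 2) * L \<le> (\<eta> 1 - e) * L" using s2 eta_1_pos L_pos by (intro mult_right_mono) auto
  ultimately have lX: "(\<eta> 1 / 4) * L \<le> ln X" using l1 by simp
  have "e * L \<le> \<epsilon> * ((\<eta> 1 / 4) * L)" using s1 L_pos by simp
  also have "\<dots> \<le> (M + \<epsilon>) * ln X"
    using lX M \<open>\<epsilon> > 0\<close> eta_1_pos L_pos by (intro mult_mono) auto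
  finally have high: "e * L \<le> (M + \<epsilon>) * ln X" .
  \<comment> \<open>The least \<open>s\<close> with \<open>Suc m - s < j\<close>; truncated
    subtraction yields 0 when \<open>m + 2 \<le> j\<close>.\<close>
  show ?thesis
  proof (rule omega_X_le_log[OF X(1,3) m _ _ _ _ high next_large, where s = "m + 2 - j"])
    assume s: "1 \<le> m + 2 - j"
    have m1: "1 \<le> m" using s j by simp
    then have am: "a m \<le> 4 * a 0 * X" "a m > 0" using Pm a_pos m by (auto simp: P_def)
    then have "ln (real (a m)) \<le> ln (8 * a 0 * X)"
      using X a0_pos by (subst ln_le_cancel_iff) auto
    then have "ln (real (a m)) - e * L \<le> ln X" using ln_8 X a0_pos by (simp add: ln_mult)
    then have lXm: "(S m - 2 * e) * L \<le> ln X" using ln_level[OF m1 m] by (simp add: algebra_simps abs_le_iff)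
    have "\<eta> (m + 2 - j) + 2 * e \<le> M * S m + 2 * e" using ratio[of m] s m by simp
    \<comment> \<open>Expanded, this reads
      \<open>2 * e * (1 + M + \<epsilon>) \<le> \<epsilon> * S m\<close>, which is where the form of
      \<open>small\<close> comes from.\<close>
    also have "\<dots> \<le> (M + \<epsilon>) * (S m - 2 * e)"
    proof -
      have "\<epsilon> * \<eta> 1 \<le> \<epsilon> * S m" using eta_le_S[of 1 m] m1 m \<open>\<epsilon> > 0\<close> by simp
      then show ?thesis using small eM e_pos by (simp add: algebra_simps)
    qed
    finally have "(\<eta> (m + 2 - j) + 2 * e) * L \<le> (M + \<epsilon>) * ((S m - 2 * e) * L)" using L_pos by simp
    also have "\<dots> \<le> (M + \<epsilon>) * ln X" using lXm M \<open>\<epsilon> > 0\<close> by (intro mult_left_mono) auto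
    finally show "(\<eta> (m + 2 - j) + 2 * e) * L \<le> (M + \<epsilon>) * ln X" .
  qed (use j m in auto)
qed

text \<open>At this \<open>X\<close> every coordinate is high (\<open>m = 0\<close>,
  \<open>s = 0\<close>), so all admissible points lie on one line and no two are independent. The
  exponent only has to beat the factor \<open>a 0\<close>, which is negligible against
  \<open>X\<close>.\<close>

lemma omega_X_sqrt_le:
  assumes "j \<ge> 2" "\<epsilon> > 0" and small: "4 * e \<le> \<epsilon> * \<eta> 1" "4 * e \<le> \<eta> 1"
  shows "omega_X k \<zeta> j (sqrt (a 1)) \<le> ereal \<epsilon>"
proof -
  have a1: "1 \<le> a 1" using a_pos[of 1] k_pos by simp
  have lev: "(\<eta> 1 - e) * L \<le> ln (real (a 1))"
    using ln_level[of 1] k_pos by (simp add: S_def algebra_simps abs_le_iff)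
  moreover have "(\<eta> 1 / 2) * L \<le> (\<eta> 1 - e) * L" using small eta_1_pos L_pos by (intro mult_right_mono) auto
  ultimately have half: "(\<eta> 1 / 2) * L \<le> ln (real (a 1))" by simp
  have "e * L \<le> \<epsilon> * ((\<eta> 1 / 4) * L)" using small L_pos by simp
  also have "\<dots> \<le> \<epsilon> * ln (sqrt (a 1))"
    using half a1 \<open>\<epsilon> > 0\<close> by (intro mult_left_mono) (auto simp: ln_sqrt mult.commute)
  finally have high: "e * L \<le> \<epsilon> * ln (sqrt (a 1))" .
  have "4 * e * L \<le> \<eta> 1 * L" using small L_pos by simp
  then have "2 * (e * L) \<le> ln (real (a 1))" using half by simp
  then have "ln (8 * a 0 * sqrt (a 1)) \<le> ln (real (a 1))"
    using ln_8 a1 a0_pos by (simp add: ln_mult ln_sqrt)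
  then have "8 * a 0 * sqrt (a 1) \<le> a 1" using a1 a0_pos by (subst (asm) ln_le_cancel_iff) auto
  moreover have "0 < a 0 * sqrt (a 1)" using a1 a0_pos by simp
  ultimately have nl: "4 * a 0 * sqrt (a 1) < a (Suc 0)" by simp
  show ?thesis
    by (rule omega_X_le_log[where s = 0 and m = 0])
      (use a1 a_mono[of 1 "Suc k"] high nl \<open>j \<ge> 2\<close> in auto)
qed

text \<open>Just below \<open>a m\<close>, coordinate \<open>m\<close> is still high while the
  exponent already makes it low, so only the zero vector is admissible. The other two conclusions
  serve to show that these \<open>X\<close> tend to infinity.\<close>

lemma omega_X_1_le:
  fixes M \<epsilon> :: real
  assumes m: "1 \<le> m" "m \<le> k" and "\<epsilon> > 0" and M: "M \<ge> 0" "\<eta> m \<le> M * S m"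
    and small: "e * (4 + 4 * M + 4 * \<epsilon>) \<le> \<epsilon> * \<eta> 1"
  shows "omega_X k \<zeta> 1 (a m / (8 * a 0)) \<le> ereal (M + \<epsilon>)"
    and "1 \<le> a m / (8 * a 0)"
    and "\<eta> 1 * L / 2 \<le> ln (a m / (8 * a 0))"
proof -
  define X where "X = a m / (8 * a 0)"
  have pos: "a m > 0" "a (Suc k) > 0" using a_pos m by auto
  then have "X > 0" using a0_pos by (simp add: X_def)
  have eM: "0 \<le> e * M" "0 \<le> e * \<epsilon>" using e_pos M \<open>\<epsilon> > 0\<close> by auto
  have s1: "4 * e \<le> \<epsilon> * \<eta> 1" using small eM by (simp add: algebra_simps)
  have "e * \<epsilon> \<le> (\<eta> 1 / 4) * \<epsilon>" using small eM e_pos by (simp add: algebra_simps)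
  then have s2: "e \<le> \<eta> 1 / 4" using \<open>\<epsilon> > 0\<close> mult_le_cancel_right_pos by blast
  have lnX: "ln X = ln (real (a m)) - ln 8 - ln (real (a 0))"
    using pos a0_pos by (simp add: X_def ln_div ln_mult)
  have lXm: "(S m - 2 * e) * L \<le> ln X"
    using ln_level[OF m] ln_8 unfolding lnX by (simp add: algebra_simps abs_le_iff)
  have "\<eta> 1 * L / 2 \<le> (S m - 2 * e) * L"
    using mult_right_mono[of "\<eta> 1 / 2" "S m - 2 * e" L] s2 eta_le_S[of 1 m] m L_pos by simp
  then have half: "\<eta> 1 * L / 2 \<le> ln X" using lXm by simp
  moreover have "0 < \<eta> 1 * L / 2" using eta_1_pos L_pos by simp
  ultimately have X1: "1 \<le> X" using \<open>X > 0\<close> by (metis less_le_trans ln_ge_zero_iff less_imp_le)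
  have "e * L \<le> \<epsilon> * (\<eta> 1 * L / 2)" using s1 L_pos e_pos by (simp add: field_simps)
  also have "\<dots> \<le> (M + \<epsilon>) * ln X"
    using half M \<open>\<epsilon> > 0\<close> eta_1_pos L_pos by (intro mult_mono) auto
  finally have high: "e * L \<le> (M + \<epsilon>) * ln X" .
  have "ln X \<le> 2 * L"
  proof -
    have "S m * L \<le> L" "e * L \<le> L" using S_le_1[of m] m e_le L_pos by auto
    moreover have "0 \<le> ln (8::real)" by simp
    ultimately show ?thesis using ln_level[OF m] ln_a0_nonneg unfolding lnX by linarith
  qed
  then have "ln (X\<^sup>2) \<le> ln (real (a (Suc k)))" using ln_top_ge L_pos \<open>X > 0\<close> by (simp add: ln_realpow)
  then have Xk: "X\<^sup>2 \<le> a (Suc k)" using \<open>X > 0\<close> pos by (subst (asm) ln_le_cancel_iff) auto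
  have "omega_X k \<zeta> 1 X \<le> ereal (M + \<epsilon>)"
  proof (rule omega_X_le_log[OF X1 Xk, where s = m and m = "m - 1"])
    have "\<eta> m + 2 * e \<le> M * S m + 2 * e" using M by simp
    also have "\<dots> \<le> (M + \<epsilon>) * (S m - 2 * e)"
    proof -
      have "\<epsilon> * \<eta> 1 \<le> \<epsilon> * S m" using eta_le_S[of 1 m] m \<open>\<epsilon> > 0\<close> by simp
      then show ?thesis using small eM e_pos by (simp add: algebra_simps)
    qed
    finally have "(\<eta> m + 2 * e) * L \<le> (M + \<epsilon>) * ((S m - 2 * e) * L)" using L_pos by simp
    also have "\<dots> \<le> (M + \<epsilon>) * ln X" using lXm M \<open>\<epsilon> > 0\<close> by (intro mult_left_mono) auto
    finally show "(\<eta> m + 2 * e) * L \<le> (M + \<epsilon>) * ln X" .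
    show "4 * a 0 * X < a (Suc (m - 1))" using m pos a0_pos by (simp add: X_def)
  qed (use m high in auto)
  then show "omega_X k \<zeta> 1 (a m / (8 * a 0)) \<le> ereal (M + \<epsilon>)"
    and "1 \<le> a m / (8 * a 0)"
    and "\<eta> 1 * L / 2 \<le> ln (a m / (8 * a 0))"
    using X1 half unfolding X_def by auto
qed

end

section \<open>The blocks of a lacunary system\<close>

locale lacunary_system = gap_weights k \<eta>
  for k :: nat and \<eta> :: "nat \<Rightarrow> real" +
  fixes q :: "nat \<Rightarrow> nat \<Rightarrow> nat" and \<zeta> :: "nat \<Rightarrow> real"
  assumes incr_in: "n \<ge> 1 \<Longrightarrow> 1 \<le> j \<Longrightarrow> j < k \<Longrightarrow> q n j < q n (j + 1)"
    and incr_next: "n \<ge> 1 \<Longrightarrow> q n k < q (n + 1) 1"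
    and dvd_in: "n \<ge> 1 \<Longrightarrow> 1 \<le> j \<Longrightarrow> j < k \<Longrightarrow> q n j dvd q n (j + 1)"
    and dvd_next: "n \<ge> 1 \<Longrightarrow> q n k dvd q (n + 1) 1"
    and lim1: "(\<lambda>n. (ln (real (q (n + 1) 1)) - ln (real (q n k))) / ln (real (q (n + 1) k)))
                 \<longlonglongrightarrow> \<eta> 1"
    and limi: "2 \<le> i \<Longrightarrow> i \<le> k \<Longrightarrow>
                 (\<lambda>n. (ln (real (q (n + 1) i)) - ln (real (q (n + 1) (i - 1)))) / ln (real (q (n + 1) k)))
                 \<longlonglongrightarrow> \<eta> i"
    and lim_inf: "filterlim (\<lambda>n. ln (real (q (n + 1) 1)) / ln (real (q n k))) at_top sequentially"
    and zeta_def: "1 \<le> j \<Longrightarrow> j \<le> k \<Longrightarrow> \<zeta> j = (\<Sum>n. 1 / real (q (n + 1) j))"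
begin

section \<open>Divisibility and growth of the denominators, and tails of the series\<close>

lemma q_mono_in: "i \<le> i' \<Longrightarrow> n \<ge> 1 \<Longrightarrow> 1 \<le> i \<Longrightarrow> i' \<le> k \<Longrightarrow> q n i \<le> q n i' \<and> q n i dvd q n i'"
proof (induction i' rule: nat_induct_at_least[of i])
  case (Suc m)
  then have "q n i \<le> q n m" "q n i dvd q n m" by auto
  then show ?case using incr_in[of n m] dvd_in[of n m] Suc by (auto intro: dvd_trans)
qed auto

lemma q_next:
  assumes "n \<ge> 1" "1 \<le> i" "i \<le> k" "1 \<le> i'" "i' \<le> k"
  shows "q n i < q (Suc n) i' \<and> q n i dvd q (Suc n) i'"
proof -
  have "q n i \<le> q n k" "q n k < q (Suc n) 1" "q (Suc n) 1 \<le> q (Suc n) i'"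
    using q_mono_in[of i k n] q_mono_in[of 1 i' "Suc n"] incr_next[of n] assms by auto
  moreover have "q n i dvd q n k" "q n k dvd q (Suc n) 1" "q (Suc n) 1 dvd q (Suc n) i'"
    using q_mono_in[of i k n] q_mono_in[of 1 i' "Suc n"] dvd_next[of n] assms by auto
  ultimately show ?thesis by (meson dvd_trans le_less_trans less_le_trans)
qed

text \<open>Zero divides only zero, but \<open>q n i\<close> divides a strictly larger
  number.\<close>

lemma q_pos: "n \<ge> 1 \<Longrightarrow> 1 \<le> i \<Longrightarrow> i \<le> k \<Longrightarrow> q n i > 0"
  using q_next[of n i i] by (metis dvd_0_left gr0I not_less0)

lemma q_double:
  assumes "n \<ge> 1" "1 \<le> i" "i \<le> k" "1 \<le> i'" "i' \<le> k"
  shows "2 * q n i \<le> q (Suc n) i'"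
proof -
  obtain g where g: "q (Suc n) i' = q n i * g" using q_next[OF assms] by (auto elim: dvdE)
  then have "g > 1" using q_next[OF assms] by (metis less_one linorder_neqE_nat mult_0_right mult_1_right
    less_irrefl not_less0)
  then show ?thesis using g by simp
qed

lemma q_growth:
  assumes "N \<ge> 1" "1 \<le> i" "i \<le> k"
  shows "2 ^ r * q N i \<le> q (r + N) i"
proof (induction r)
  case (Suc r)
  then have "2 ^ Suc r * q N i \<le> 2 * q (r + N) i" by simp
  also have "\<dots> \<le> q (Suc r + N) i" using q_double[of "r + N" i i] assms by simp
  finally show ?case .
qed simp

lemma q_dvd_last: "n \<ge> r \<Longrightarrow> r \<ge> 1 \<Longrightarrow> 1 \<le> i \<Longrightarrow> i \<le> k \<Longrightarrow> q r i dvd q n k"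
proof (induction n rule: nat_induct_at_least[of r])
  case base
  then show ?case using q_mono_in[of i k r] by simp
next
  case (Suc n)
  then show ?case using q_next[of n k k] k_pos by (auto intro: dvd_trans)
qed

text \<open>The doubling in \<open>q_growth\<close> dominates the tail by a geometric series of
  ratio 1/2, whose sum is twice its first term.\<close>

lemma tail_bound:
  assumes "N \<ge> 1" "1 \<le> i" "i \<le> k"
  shows "summable (\<lambda>r. 1 / real (q (r + N) i))"
    and "(\<Sum>r. 1 / real (q (r + N) i)) \<le> 2 / q N i"
proof -
  have bound: "1 / real (q (r + N) i) \<le> 1 / q N i * (1 / 2) ^ r" for r
  proof -
    have "real (2 ^ r * q N i) \<le> real (q (r + N) i)" using q_growth[OF assms] by (simp only: of_nat_le_iff)
    moreover have "0 < real (2 ^ r * q N i)" using q_pos[OF assms] by simp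
    ultimately have "1 / real (q (r + N) i) \<le> 1 / real (2 ^ r * q N i)"
      by (intro divide_left_mono) auto
    then show ?thesis by (simp add: power_divide mult.commute)
  qed
  have geo: "summable (\<lambda>r. 1 / real (q N i) * (1 / 2) ^ r)" by (intro summable_mult summable_geometric) simp
  show sm: "summable (\<lambda>r. 1 / real (q (r + N) i))"
    by (rule summable_comparison_test'[OF geo, of 0]) (use bound in simp)
  have "(\<Sum>r. 1 / real (q (r + N) i)) \<le> (\<Sum>r. 1 / real (q N i) * (1 / 2) ^ r)"
    using bound by (intro suminf_le sm geo)
  also have "\<dots> = 2 / q N i" by (subst suminf_mult) (auto simp: suminf_geometric intro: summable_geometric)
  finally show "(\<Sum>r. 1 / real (q (r + N) i)) \<le> 2 / q N i" .
qed

section \<open>Cutting the series into blocks\<close>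

definition blk :: "nat \<Rightarrow> nat \<Rightarrow> nat" where
  "blk n i = (if i = 0 then q n k else if i \<le> k then q (Suc n) i else q (Suc (Suc n)) 1)"

definition head :: "nat \<Rightarrow> nat \<Rightarrow> real" where
  "head n i = (\<Sum>r<n. 1 / real (q (Suc r) i))"

definition L :: "nat \<Rightarrow> real" where
  "L n = ln (real (q (Suc n) k))"

lemma zeta_split:
  assumes "1 \<le> i" "i \<le> k"
  shows "\<zeta> i = head n i + (\<Sum>r. 1 / real (q (r + Suc n) i))"
  using suminf_split_initial_segment[OF tail_bound(1)[of 1 i], of n] assms
  by (simp add: zeta_def head_def)

text \<open>Integrality holds because all denominators in \<open>head n i\<close> divide
  \<open>q n k\<close>. The bounds on \<open>\<zeta> i\<close> follow from
  \<open>tail_bound\<close>, applied to the whole tail or after splitting off its first term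
  \<open>1 / blk n i\<close>.\<close>

lemma divisor_chain_block_blk:
  assumes n: "n \<ge> 1"
  shows "divisor_chain_block k (blk n) (head n) \<zeta>"
proof
  show "blk n 0 > 0" using q_pos[of n k] n k_pos by (simp add: blk_def)
  show "blk n i dvd blk n (Suc i)" if "i < k" for i
    using that dvd_next[of n] dvd_in[of "Suc n" i] n by (auto simp: blk_def)
  show "blk n i < blk n (Suc i)" if "i \<le> k" for i
    using that incr_next[of n] incr_in[of "Suc n" i] incr_next[of "Suc n"] n k_pos
    by (cases "i = k") (auto simp: blk_def)
  fix i assume i: "1 \<le> i" "i \<le> k"
  have bi: "blk n i = q (Suc n) i" "blk n (Suc k) = q (Suc (Suc n)) 1" using i by (auto simp: blk_def)
  have "real (q n k) * (1 / real (q (Suc r) i)) \<in> \<int>" if r: "r < n" for r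
  proof -
    obtain g where g: "q n k = q (Suc r) i * g" using q_dvd_last[of "Suc r" n i] r i by (auto elim: dvdE)
    have "q (Suc r) i > 0" using q_pos i by simp
    then have "real (q n k) * (1 / real (q (Suc r) i)) = real g" by (simp add: g)
    then show ?thesis by simp
  qed
  then show "real (blk n 0) * head n i \<in> \<int>"
    unfolding head_def sum_distrib_left by (intro Ints_sum) (simp add: blk_def)
  have t: "(\<Sum>r. 1 / real (q (r + Suc n) i)) =
      1 / real (q (Suc n) i) + (\<Sum>r. 1 / real (q (r + Suc (Suc n)) i))"
    using suminf_split_initial_segment[OF tail_bound(1)[of "Suc n" i], of 1] i by simp
  have t0: "0 \<le> (\<Sum>r. 1 / real (q (r + Suc (Suc n)) i))"
    using tail_bound(1)[of "Suc (Suc n)" i] i by (intro suminf_nonneg) auto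
  show "head n i + 1 / real (blk n i) \<le> \<zeta> i" unfolding zeta_split[OF i, of n] t bi using t0 by simp
  have "2 / real (q (Suc (Suc n)) i) \<le> 2 / real (q (Suc (Suc n)) 1)"
    using q_mono_in[of 1 i "Suc (Suc n)"] q_pos[of "Suc (Suc n)"] i by (intro divide_left_mono) auto
  then show "\<zeta> i \<le> head n i + 1 / real (blk n i) + 2 / real (blk n (Suc k))"
    unfolding zeta_split[OF i, of n] t bi using tail_bound(2)[of "Suc (Suc n)" i] i by simp
  show "\<zeta> i \<le> head n i + 2 / real (blk n i)"
    unfolding zeta_split[OF i, of n] bi using tail_bound(2)[of "Suc n" i] i by simp
qed

section \<open>Logarithmic asymptotics of the blocks\<close>

lemma filterlim_q:
  assumes "1 \<le> i" "i \<le> k"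
  shows "filterlim (\<lambda>n. real (q (Suc n) i)) at_top sequentially"
proof (rule filterlim_at_top_mono)
  show "filterlim (\<lambda>n. real n) at_top sequentially" by (rule filterlim_real_sequentially)
  have "n \<le> q (Suc n) i" for n
  proof -
    have "n \<le> 2 ^ n * 1" using less_exp[of n] by simp
    also have "\<dots> \<le> 2 ^ n * q 1 i" using q_pos[of 1 i] assms by (intro mult_left_mono) auto
    also have "\<dots> \<le> q (Suc n) i" using q_growth[of 1 i n] assms by simp
    finally show ?thesis .
  qed
  then show "\<forall>\<^sub>F n in sequentially. real n \<le> real (q (Suc n) i)" by simp
qed

lemma filterlim_L: "filterlim L at_top sequentially"
  unfolding L_def using k_pos by (intro filterlim_compose[OF ln_at_top] filterlim_q) auto

lemma eventually_L_pos: "\<forall>\<^sub>F n in sequentially. L n > 0"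
  using filterlim_L by (auto simp: filterlim_at_top_dense)

text \<open>Inverting \<open>lim_inf\<close> gives this limit with \<open>ln (q (Suc n) 1)\<close>
  as denominator, and \<open>L n\<close> is at least as large.\<close>

lemma tendsto_level_0: "(\<lambda>n. ln (real (blk n 0)) / L n) \<longlonglongrightarrow> 0"
proof (rule tendsto_sandwich[OF _ _ tendsto_const])
  have "(\<lambda>n. inverse (ln (real (q (n + 1) 1)) / ln (real (q n k)))) \<longlonglongrightarrow> 0"
    using lim_inf by (rule tendsto_inverse_0_at_top)
  then show "(\<lambda>n. ln (real (q n k)) / ln (real (q (Suc n) 1))) \<longlonglongrightarrow> 0" by simp
  have ge1: "1 \<le> q n k" if "n \<ge> 1" for n using q_pos[of n k] that k_pos by simp
  show "\<forall>\<^sub>F n in sequentially. 0 \<le> ln (real (blk n 0)) / L n"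
    using eventually_ge_at_top[of 1] eventually_L_pos
    by eventually_elim (use ge1 in \<open>auto simp: blk_def\<close>)
  show "\<forall>\<^sub>F n in sequentially. ln (real (blk n 0)) / L n \<le> ln (real (q n k)) / ln (real (q (Suc n) 1))"
    using eventually_ge_at_top[of 1] eventually_L_pos
  proof eventually_elim
    case (elim n)
    have "1 < q (Suc n) 1" using incr_next[of n] ge1[of n] elim by simp
    moreover have "q (Suc n) 1 \<le> q (Suc n) k" using q_mono_in[of 1 k "Suc n"] k_pos by simp
    ultimately show ?case using elim ge1[of n]
      by (auto simp: blk_def L_def intro!: divide_left_mono mult_pos_pos)
  qed
qed

lemma tendsto_gap:
  assumes "1 \<le> i" "i \<le> k"
  shows "(\<lambda>n. (ln (real (blk n i)) - ln (real (blk n (i - 1)))) / L n) \<longlonglongrightarrow> \<eta> i"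
proof (cases "i = 1")
  case True
  then show ?thesis using lim1 assms by (simp add: blk_def L_def)
next
  case False
  then have "2 \<le> i" "i - 1 \<noteq> 0" "i - 1 \<le> k" using assms by auto
  then show ?thesis using limi[of i] assms by (simp add: blk_def L_def)
qed

text \<open>The gaps telescope, starting from the negligible level 0.\<close>

lemma tendsto_level:
  "i \<le> k \<Longrightarrow> (\<lambda>n. ln (real (blk n i)) / L n) \<longlonglongrightarrow> S i"
proof (induction i)
  case 0
  then show ?case using tendsto_level_0 by (simp add: S_def)
next
  case (Suc i)
  have "(\<lambda>n. ln (real (blk n i)) / L n + (ln (real (blk n (Suc i))) - ln (real (blk n i))) / L n)
    \<longlonglongrightarrow> S i + \<eta> (Suc i)"
    using Suc tendsto_gap[of "Suc i"] by (intro tendsto_add) auto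
  then show ?case by (simp add: S_def diff_divide_distrib)
qed

lemma filterlim_top: "filterlim (\<lambda>n. ln (real (blk n (Suc k))) / L n) at_top sequentially"
  using filterlim_compose[OF lim_inf filterlim_Suc] by (simp add: blk_def L_def)

lemma eventually_abs_diff_le:
  assumes "(\<lambda>n. f n / L n) \<longlonglongrightarrow> c" "e > 0"
  shows "\<forall>\<^sub>F n in sequentially. \<bar>f n - c * L n\<bar> \<le> e * L n"
  using tendstoD[OF assms] eventually_L_pos
proof eventually_elim
  case (elim n)
  have "\<bar>f n - c * L n\<bar> = \<bar>f n / L n - c\<bar> * L n"
    using elim(2) abs_mult[of "f n / L n - c" "L n"] by (simp add: left_diff_distrib)
  also have "\<dots> \<le> e * L n" using elim by (intro mult_right_mono) (auto simp: dist_real_def)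
  finally show ?case .
qed

text \<open>A block has only finitely many conditions, each a limit in units of \<open>L n\<close>;
  the constant \<open>ln 8\<close> disappears because \<open>L n\<close> tends to infinity.\<close>

lemma eventually_controlled:
  assumes "0 < e" "e \<le> 1 / 8"
  shows "\<forall>\<^sub>F n in sequentially. n \<ge> 1 \<and> controlled_block k (blk n) (head n) \<zeta> \<eta> e (L n)"
proof -
  have gap: "\<forall>\<^sub>F n in sequentially. \<forall>i\<in>{1..k}.
      \<bar>ln (real (blk n i)) - ln (real (blk n (i - 1))) - \<eta> i * L n\<bar> \<le> e * L n"
    using tendsto_gap assms by (intro eventually_ball_finite ballI eventually_abs_diff_le) auto
  have level: "\<forall>\<^sub>F n in sequentially. \<forall>i\<in>{1..k}. \<bar>ln (real (blk n i)) - S i * L n\<bar> \<le> e * L n"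
    using tendsto_level assms by (intro eventually_ball_finite ballI eventually_abs_diff_le) auto
  have "(\<lambda>n. ln 8 / L n) \<longlonglongrightarrow> 0"
    by (rule real_tendsto_divide_at_top[OF tendsto_const filterlim_L])
  then have "(\<lambda>n. ln 8 / L n + ln (real (blk n 0)) / L n) \<longlonglongrightarrow> 0 + 0"
    using tendsto_level_0 by (rule tendsto_add)
  then have "(\<lambda>n. (ln 8 + ln (real (blk n 0))) / L n) \<longlonglongrightarrow> 0" by (simp add: add_divide_distrib)
  then have a0: "\<forall>\<^sub>F n in sequentially. \<bar>ln 8 + ln (real (blk n 0)) - 0 * L n\<bar> \<le> e * L n"
    using assms by (intro eventually_abs_diff_le)
  have top: "\<forall>\<^sub>F n in sequentially. 1 / e < ln (real (blk n (Suc k))) / L n"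
    using filterlim_top by (auto simp: filterlim_at_top_dense)
  show ?thesis
    using eventually_ge_at_top[of 1] eventually_L_pos gap level a0 top
  proof eventually_elim
    case (elim n)
    interpret divisor_chain_block k "blk n" "head n" \<zeta> using elim by (intro divisor_chain_block_blk)
    have "controlled_block k (blk n) (head n) \<zeta> \<eta> e (L n)"
    proof
      show "ln (8 * real (blk n 0)) \<le> e * L n" using elim(5) a0_pos by (simp add: ln_mult)
      show "L n / e \<le> ln (real (blk n (Suc k)))" using elim(2,6) assms by (simp add: field_simps)
    qed (use elim assms in auto)
    then show ?case using elim by simp
  qed
qed

end

section \<open>The approximation constants\<close>

lemma le_Limsup_at_top_seq:
  fixes f :: "real \<Rightarrow> ereal"
  assumes "filterlim X at_top sequentially" "\<forall>\<^sub>F n in sequentially. C \<le> f (X n)"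
  shows "C \<le> Limsup at_top f"
proof (rule ccontr)
  assume "\<not> C \<le> Limsup at_top f"
  then have "\<forall>\<^sub>F x in at_top. f x < C" by (intro Limsup_lessD) simp
  then have "\<forall>\<^sub>F n in sequentially. f (X n) < C"
    using assms(1) by (auto simp: filterlim_iff)
  with assms(2) have "\<forall>\<^sub>F n in sequentially. False" by eventually_elim simp
  then show False by simp
qed

lemma Liminf_at_top_seq_le:
  fixes f :: "real \<Rightarrow> ereal"
  assumes "filterlim X at_top sequentially" "\<forall>\<^sub>F n in sequentially. f (X n) \<le> C"
  shows "Liminf at_top f \<le> C"
proof (rule ccontr)
  assume "\<not> Liminf at_top f \<le> C"
  then have "\<forall>\<^sub>F x in at_top. C < f x" by (intro less_LiminfD) simp
  then have "\<forall>\<^sub>F n in sequentially. C < f (X n)"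
    using assms(1) by (auto simp: filterlim_iff)
  with assms(2) have "\<forall>\<^sub>F n in sequentially. False" by eventually_elim simp
  then show False by simp
qed

lemma eventually_at_top_intervals:
  fixes b :: "nat \<Rightarrow> real"
  assumes "filterlim b at_top sequentially"
    and "\<forall>\<^sub>F n in sequentially. \<forall>X. b n \<le> X \<longrightarrow> X < b (Suc n) \<longrightarrow> P X"
  shows "\<forall>\<^sub>F X in at_top. P X"
proof -
  obtain N where N: "\<And>n X. n \<ge> N \<Longrightarrow> b n \<le> X \<Longrightarrow> X < b (Suc n) \<Longrightarrow> P X"
    using assms(2) by (auto simp: eventually_sequentially)
  have "P X" if X: "X \<ge> b N" for X
  proof -
    have "\<forall>\<^sub>F n in sequentially. X < b n" using assms(1) by (auto simp: filterlim_at_top_dense)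
    then obtain N' where N': "\<And>n. n \<ge> N' \<Longrightarrow> X < b n" by (auto simp: eventually_sequentially)
    \<comment> \<open>The first index at which \<open>b\<close> exceeds \<open>X\<close>: its
      predecessor still has \<open>b \<le> X\<close>, so \<open>X\<close> lies in the interval
      between them. Monotonicity of \<open>b\<close> is not assumed.\<close>
    define d where "d = (LEAST d. X < b (N + d))"
    have d: "X < b (N + d)" unfolding d_def by (rule LeastI[of _ N']) (use N' in simp)
    then have "d \<noteq> 0" using X by (auto intro: ccontr)
    then obtain d' where d': "d = Suc d'" by (cases d) auto
    then have "\<not> X < b (N + d')" using not_less_Least[of d' "\<lambda>d. X < b (N + d)"] d_def by simp
    then show ?thesis using N[of "N + d'" X] d d' by simp
  qed
  then show ?thesis by (auto simp: eventually_at_top_linorder)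
qed

lemma small_positive_exists:
  fixes c K :: real
  assumes "c > 0" "K > 0"
  shows "\<exists>e>0. e \<le> 1 / 8 \<and> e * K \<le> c"
proof -
  define e where "e = min (1 / 8) (c / K)"
  have "e * K \<le> c / K * K" using assms unfolding e_def by (intro mult_right_mono) auto
  moreover have "0 < e" "e \<le> 1 / 8" using assms by (simp_all add: e_def del: divide_le_eq_numeral1 le_divide_eq_numeral1)
  ultimately show ?thesis using assms by (intro exI[of _ e]) simp
qed

context lacunary_system
begin

lemma filterlim_q_last: "filterlim (\<lambda>n. real (q n k)) at_top sequentially"
  using filterlim_q[of k] k_pos by (subst filterlim_sequentially_Suc[symmetric]) auto

lemma filterlim_blk:
  assumes "i \<le> k"
  shows "filterlim (\<lambda>n. real (blk n i)) at_top sequentially"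
  using filterlim_q_last filterlim_q[of i] assms by (cases "i = 0") (auto simp: blk_def)

text \<open>At \<open>X = blk n 0\<close> the point with \<open>x = blk n 0\<close> has an error of
  logarithmic size about \<open>- \<eta> 1 * L n\<close>, while \<open>ln X\<close> is negligible
  against \<open>L n\<close>; so every exponent is reached.\<close>

lemma omega_1: "omega k \<zeta> 1 = \<infinity>"
proof -
  have "ereal \<nu> \<le> omega k \<zeta> 1" for \<nu>
  proof -
    obtain e where e: "0 < e" "e \<le> 1 / 8" "e * (2 + \<bar>\<nu>\<bar>) \<le> \<eta> 1"
      using small_positive_exists[of "\<eta> 1" "2 + \<bar>\<nu>\<bar>"] eta_1_pos by (auto simp: add_pos_nonneg)
    have "\<forall>\<^sub>F n in sequentially. ereal \<nu> \<le> omega_X k \<zeta> 1 (real (blk n 0))"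
      using eventually_controlled[OF e(1,2)]
    proof eventually_elim
      case (elim n)
      interpret B: controlled_block k "blk n" "head n" \<zeta> \<eta> e "L n" using elim by simp
      show ?case
      proof (rule B.omega_X_ge_log[where p = 0])
        have "\<nu> * ln (real (blk n 0)) \<le> \<bar>\<nu>\<bar> * ln (real (blk n 0))"
          using B.ln_a0_nonneg by (intro mult_right_mono) auto
        also have "\<dots> \<le> \<bar>\<nu>\<bar> * (e * L n)"
        proof -
          have "0 \<le> ln (8::real)" by simp
          then show ?thesis using B.ln_8 by (intro mult_left_mono) linarith+
        qed
        also have "\<dots> \<le> (\<eta> 1 - 2 * e) * L n"
          using mult_right_mono[OF e(3), of "L n"] B.L_pos by (simp add: algebra_simps)
        finally show "\<nu> * ln (real (blk n 0)) \<le> (\<eta> (Suc 0) - 2 * e) * L n" by simp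
      qed (use k_pos in auto)
    qed
    then show ?thesis unfolding omega_def by (intro le_Limsup_at_top_seq[OF filterlim_blk[of 0]]) auto
  qed
  then show ?thesis by (metis ereal_infty_less_eq(1) ereal_top)
qed

text \<open>At \<open>X = blk n m\<close>, of logarithmic size \<open>S m\<close>, the
  \<open>j\<close> points with \<open>x = blk n i\<close>, \<open>m + 1 - j \<le> i \<le> m\<close>,
  are available, and their narrowest gap is \<open>\<eta> (m + 2 - j)\<close>.\<close>

lemma omega_ge:
  assumes j: "2 \<le> j" and m: "j - 1 \<le> m" "m \<le> k"
  shows "ereal (\<eta> (m + 2 - j) / S m) \<le> omega k \<zeta> j"
proof (rule ereal_le_epsilon2)
  fix \<epsilon> :: real assume "\<epsilon> > 0"
  define p where "p = m + 1 - j"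
  have p: "Suc p = m + 2 - j" "p + j = Suc m" "p < k" using j m by (auto simp: p_def)
  have m1: "1 \<le> m" using j m by simp
  have Sm: "\<eta> 1 \<le> S m" "S m > 0" using eta_le_S[of 1 m] S_pos m1 m by auto
  define \<nu> where "\<nu> = \<eta> (Suc p) / S m - \<epsilon>"
  have \<nu>S: "\<nu> * S m = \<eta> (Suc p) - \<epsilon> * S m" using Sm by (simp add: \<nu>_def field_simps)
  obtain e where e: "0 < e" "e \<le> 1 / 8" "e * (2 + \<bar>\<nu>\<bar>) \<le> \<epsilon> * \<eta> 1"
    using small_positive_exists[of "\<epsilon> * \<eta> 1" "2 + \<bar>\<nu>\<bar>"] eta_1_pos \<open>\<epsilon> > 0\<close>
    by (auto simp: add_pos_nonneg)
  have "\<forall>\<^sub>F n in sequentially. ereal \<nu> \<le> omega_X k \<zeta> j (real (blk n m))"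
    using eventually_controlled[OF e(1,2)]
  proof eventually_elim
    case (elim n)
    interpret B: controlled_block k "blk n" "head n" \<zeta> \<eta> e "L n" using elim by simp
    show ?case
    proof (rule B.omega_X_ge_log[where p = p])
      \<comment> \<open>\<open>\<nu>\<close> may be negative, so the error of the level enters with
        the factor \<open>\<bar>\<nu>\<bar>\<close>.\<close>
      have "\<nu> * ln (real (blk n m)) - \<nu> * (S m * L n) \<le> \<bar>\<nu> * (ln (real (blk n m)) - S m * L n)\<bar>"
        by (simp add: algebra_simps)
      also have "\<dots> \<le> \<bar>\<nu>\<bar> * (e * L n)"
        unfolding abs_mult using B.ln_level[of m] j m by (intro mult_left_mono) auto
      finally have "\<nu> * ln (real (blk n m)) \<le> (\<nu> * S m + e * \<bar>\<nu>\<bar>) * L n" by (simp add: algebra_simps)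
      also have "\<dots> \<le> (\<eta> (Suc p) - 2 * e) * L n"
      proof (rule mult_right_mono)
        have "\<epsilon> * \<eta> 1 \<le> \<epsilon> * S m" using Sm \<open>\<epsilon> > 0\<close> by simp
        then show "\<nu> * S m + e * \<bar>\<nu>\<bar> \<le> \<eta> (Suc p) - 2 * e" using e(3) unfolding \<nu>S by (simp add: algebra_simps)
      qed (use B.L_pos in simp)
      finally show "\<nu> * ln (real (blk n m)) \<le> (\<eta> (Suc p) - 2 * e) * L n" .
    qed (use p j m in auto)
  qed
  then have "ereal \<nu> \<le> omega k \<zeta> j"
    unfolding omega_def using m by (intro le_Limsup_at_top_seq[OF filterlim_blk[of m]]) auto
  then have "ereal \<nu> + ereal \<epsilon> \<le> omega k \<zeta> j + ereal \<epsilon>" by (rule add_right_mono)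
  then show "ereal (\<eta> (m + 2 - j) / S m) \<le> omega k \<zeta> j + ereal \<epsilon>" by (simp add: \<nu>_def p(1))
qed

text \<open>The half-line is cut at the square roots of \<open>q (Suc n) 1\<close>: on each piece
  \<open>blk n 1 \<le> X\<^sup>2 \<le> blk n (Suc k)\<close>, which is the range covered by
  \<open>omega_X_le_of_ratio\<close>.\<close>

lemma omega_le:
  assumes j: "2 \<le> j" and M: "M \<ge> 0"
    and ratio: "\<And>m. j - 1 \<le> m \<Longrightarrow> m \<le> k \<Longrightarrow> \<eta> (m + 2 - j) \<le> M * S m"
  shows "omega k \<zeta> j \<le> ereal M"
proof (rule ereal_le_epsilon2)
  fix \<epsilon> :: real assume "\<epsilon> > 0"
  obtain e where e: "0 < e" "e \<le> 1 / 8" "e * (4 + 4 * M + 4 * \<epsilon>) \<le> \<epsilon> * \<eta> 1"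
    using small_positive_exists[of "\<epsilon> * \<eta> 1" "4 + 4 * M + 4 * \<epsilon>"] eta_1_pos \<open>\<epsilon> > 0\<close> M by auto
  have "\<forall>\<^sub>F X in at_top. omega_X k \<zeta> j X \<le> ereal (M + \<epsilon>)"
  proof (rule eventually_at_top_intervals)
    show "filterlim (\<lambda>n. sqrt (real (q (Suc n) 1))) at_top sequentially"
      using k_pos by (intro filterlim_compose[OF sqrt_at_top] filterlim_q) auto
    show "\<forall>\<^sub>F n in sequentially. \<forall>X. sqrt (real (q (Suc n) 1)) \<le> X \<longrightarrow>
        X < sqrt (real (q (Suc (Suc n)) 1)) \<longrightarrow> omega_X k \<zeta> j X \<le> ereal (M + \<epsilon>)"
      using eventually_controlled[OF e(1,2)]
    proof (eventually_elim, intro allI impI)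
      fix n and X :: real
      assume n: "n \<ge> 1 \<and> controlled_block k (blk n) (head n) \<zeta> \<eta> e (L n)"
        and X: "sqrt (real (q (Suc n) 1)) \<le> X" "X < sqrt (real (q (Suc (Suc n)) 1))"
      interpret B: controlled_block k "blk n" "head n" \<zeta> \<eta> e "L n" using n by simp
      have "1 \<le> real (q (Suc n) 1)" using q_pos[of "Suc n" 1] k_pos by simp
      then have X1: "1 \<le> X" using X(1) real_sqrt_ge_one order_trans by blast
      have b: "blk n 1 = q (Suc n) 1" "blk n (Suc k) = q (Suc (Suc n)) 1" using k_pos by (auto simp: blk_def)
      show "omega_X k \<zeta> j X \<le> ereal (M + \<epsilon>)"
      proof (rule B.omega_X_le_of_ratio[OF j M \<open>\<epsilon> > 0\<close> ratio e(3) X1])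
        show "real (blk n 1) \<le> X\<^sup>2" unfolding b by (rule sqrt_le_D[OF X(1)])
        have "X\<^sup>2 \<le> (sqrt (real (q (Suc (Suc n)) 1)))\<^sup>2" using X X1 by (intro power_mono) auto
        then show "X\<^sup>2 \<le> real (blk n (Suc k))" unfolding b by simp
      qed auto
    qed
  qed
  then have "omega k \<zeta> j \<le> ereal (M + \<epsilon>)" unfolding omega_def by (rule Limsup_bounded)
  then show "omega k \<zeta> j \<le> ereal M + ereal \<epsilon>" by simp
qed

lemma omega_hat_eq_0:
  assumes j: "2 \<le> j" "j \<le> k + 1"
  shows "omega_hat k \<zeta> j = 0"
proof (rule antisym)
  have "\<forall>\<^sub>F X in at_top. 0 \<le> omega_X k \<zeta> j X"
    using eventually_ge_at_top[of "1::real"] by eventually_elim (use j in \<open>auto intro: omega_X_nonneg\<close>)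
  then show "0 \<le> omega_hat k \<zeta> j" unfolding omega_hat_def by (rule Liminf_bounded)
  show "omega_hat k \<zeta> j \<le> 0"
  proof (rule ereal_le_epsilon2)
    fix \<epsilon> :: real assume "\<epsilon> > 0"
    obtain e where e: "0 < e" "e \<le> 1 / 8" "e * 4 \<le> min (\<epsilon> * \<eta> 1) (\<eta> 1)"
      using small_positive_exists[of "min (\<epsilon> * \<eta> 1) (\<eta> 1)" 4] eta_1_pos \<open>\<epsilon> > 0\<close> by auto
    have "\<forall>\<^sub>F n in sequentially. omega_X k \<zeta> j (sqrt (blk n 1)) \<le> ereal \<epsilon>"
      using eventually_controlled[OF e(1,2)]
    proof eventually_elim
      case (elim n)
      interpret B: controlled_block k "blk n" "head n" \<zeta> \<eta> e "L n" using elim by simp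
      show ?case using e j \<open>\<epsilon> > 0\<close> by (intro B.omega_X_sqrt_le) auto
    qed
    then have "omega_hat k \<zeta> j \<le> ereal \<epsilon>"
      unfolding omega_hat_def using k_pos
      by (intro Liminf_at_top_seq_le[where X = "\<lambda>n. sqrt (blk n 1)"]
          filterlim_compose[OF sqrt_at_top] filterlim_blk) auto
    then show "omega_hat k \<zeta> j \<le> 0 + ereal \<epsilon>" by simp
  qed
qed

lemma omega_hat_1_le:
  assumes m: "1 \<le> m" "m \<le> k"
  shows "omega_hat k \<zeta> 1 \<le> ereal (\<eta> m / S m)"
proof (rule ereal_le_epsilon2)
  fix \<epsilon> :: real assume "\<epsilon> > 0"
  define M where "M = \<eta> m / S m"
  have Sm: "S m > 0" using S_pos m by simp
  have M: "M \<ge> 0" "\<eta> m \<le> M * S m" using Sm eta_pos[OF m] by (auto simp: M_def)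
  obtain e where e: "0 < e" "e \<le> 1 / 8" "e * (4 + 4 * M + 4 * \<epsilon>) \<le> \<epsilon> * \<eta> 1"
    using small_positive_exists[of "\<epsilon> * \<eta> 1" "4 + 4 * M + 4 * \<epsilon>"] eta_1_pos \<open>\<epsilon> > 0\<close> M by auto
  have ev: "\<forall>\<^sub>F n in sequentially. omega_X k \<zeta> 1 (blk n m / (8 * blk n 0)) \<le> ereal (M + \<epsilon>)
      \<and> \<eta> 1 / 2 * L n \<le> blk n m / (8 * blk n 0)"
    using eventually_controlled[OF e(1,2)]
  proof eventually_elim
    case (elim n)
    interpret B: controlled_block k "blk n" "head n" \<zeta> \<eta> e "L n" using elim by simp
    note B = B.omega_X_1_le[OF m \<open>\<epsilon> > 0\<close> M e(3)]
    \<comment> \<open>\<open>X\<close> dominates \<open>ln X\<close>, hence a positive multiple of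
      \<open>L n\<close>, so the chosen \<open>X\<close> tend to infinity.\<close>
    have "ln (blk n m / (8 * blk n 0)) \<le> blk n m / (8 * blk n 0)" using B(2) by (intro ln_bound) linarith
    then show ?case using B by simp
  qed
  have "filterlim (\<lambda>n. \<eta> 1 / 2 * L n) at_top sequentially"
    using eta_1_pos by (intro filterlim_tendsto_pos_mult_at_top[OF tendsto_const _ filterlim_L]) auto
  then have "filterlim (\<lambda>n. blk n m / (8 * blk n 0)) at_top sequentially"
    by (rule filterlim_at_top_mono) (use ev in \<open>auto elim: eventually_mono\<close>)
  then have "omega_hat k \<zeta> 1 \<le> ereal (M + \<epsilon>)"
    unfolding omega_hat_def
    by (rule Liminf_at_top_seq_le) (use ev in \<open>auto elim: eventually_mono\<close>)
  then show "omega_hat k \<zeta> 1 \<le> ereal (\<eta> m / S m) + ereal \<epsilon>" by (simp add: M_def)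
qed

text \<open>If \<open>blk n (m - 1) \<le> X < blk n m\<close>, the single point with
  \<open>x = blk n (m - 1)\<close> has logarithmic error about \<open>- \<eta> m * L n\<close>,
  while \<open>ln X\<close> is at most about \<open>S m * L n\<close>.\<close>

lemma omega_hat_1_ge:
  assumes ratio: "\<And>m. 1 \<le> m \<Longrightarrow> m \<le> k \<Longrightarrow> \<mu> * S m \<le> \<eta> m"
  shows "ereal \<mu> \<le> omega_hat k \<zeta> 1"
proof (rule ereal_le_epsilon2)
  fix \<epsilon> :: real assume "\<epsilon> > 0"
  define \<nu> where "\<nu> = \<mu> - \<epsilon>"
  obtain e where e: "0 < e" "e \<le> 1 / 8" "e * (2 + \<bar>\<nu>\<bar>) \<le> min (\<epsilon> * \<eta> 1) (\<eta> 1)"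
    using small_positive_exists[of "min (\<epsilon> * \<eta> 1) (\<eta> 1)" "2 + \<bar>\<nu>\<bar>"] eta_1_pos \<open>\<epsilon> > 0\<close>
    by (auto simp: add_pos_nonneg)
  have "\<forall>\<^sub>F X in at_top. ereal \<nu> \<le> omega_X k \<zeta> 1 X"
  proof (rule eventually_at_top_intervals[OF filterlim_q_last])
    show "\<forall>\<^sub>F n in sequentially. \<forall>X. real (q n k) \<le> X \<longrightarrow> X < real (q (Suc n) k) \<longrightarrow>
        ereal \<nu> \<le> omega_X k \<zeta> 1 X"
      using eventually_controlled[OF e(1,2)]
    proof (eventually_elim, intro allI impI)
      fix n and X :: real
      assume n: "n \<ge> 1 \<and> controlled_block k (blk n) (head n) \<zeta> \<eta> e (L n)"
        and X: "real (q n k) \<le> X" "X < real (q (Suc n) k)"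
      interpret B: controlled_block k "blk n" "head n" \<zeta> \<eta> e "L n" using n by simp
      define P where "P m \<longleftrightarrow> X < blk n m" for m
      define m where "m = Least P"
      have "P k" using X k_pos by (simp add: P_def blk_def)
      then have Pm: "P m" "m \<le> k" unfolding m_def by (rule LeastI, rule Least_le)
      have "\<not> P 0" using X by (simp add: P_def blk_def)
      then have "m \<noteq> 0" using Pm by metis
      then have m: "1 \<le> m" "m \<le> k" using Pm by auto
      have "\<not> P (m - 1)" using m unfolding m_def by (intro not_less_Least) simp
      then have lo: "blk n (m - 1) \<le> X" by (simp add: P_def)
      have hi: "X < blk n m" using Pm by (simp add: P_def)
      have "0 < blk n (m - 1)" using m by (intro B.a_pos) simp
      then have "1 \<le> real (blk n (m - 1))" by simp
      then have "1 \<le> X" using lo by linarith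
      then have lnX: "0 \<le> ln X" "ln X \<le> ln (blk n m)" using hi by auto
      have "\<nu> * ln X \<le> (\<eta> m - 2 * e) * L n"
      \<comment> \<open>The upper bound on \<open>ln X\<close> helps only for
        \<open>\<nu> > 0\<close>; otherwise the left side is nonpositive and
        \<open>2 * e \<le> \<eta> m\<close> suffices, which is why \<open>e\<close> was also bounded
        through \<open>\<eta> 1\<close>.\<close>
      proof (cases "\<nu> \<le> 0")
        case True
        then have "\<nu> * ln X \<le> 0" using lnX by (simp add: mult_nonpos_nonneg)
        moreover have "0 \<le> e * \<bar>\<nu>\<bar>" using e by simp
        then have "2 * e \<le> \<eta> m" using e(3) eta_mono[of 1 m] m by (simp add: algebra_simps)
        then have "0 \<le> (\<eta> m - 2 * e) * L n" using B.L_pos by simp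
        ultimately show ?thesis by linarith
      next
        case False
        have "ln (real (blk n m)) \<le> (S m + e) * L n"
          using B.ln_level[OF m] by (simp add: algebra_simps abs_le_iff)
        then have "\<nu> * ln X \<le> \<nu> * ((S m + e) * L n)"
          using lnX False by (intro mult_left_mono) auto
        also have "\<dots> = (\<nu> * (S m + e)) * L n" by simp
        also have "\<dots> \<le> (\<eta> m - 2 * e) * L n"
        proof (rule mult_right_mono)
          have "\<epsilon> * \<eta> 1 \<le> \<epsilon> * S m" using eta_le_S[of 1 m] m \<open>\<epsilon> > 0\<close> by simp
          moreover have "\<nu> * S m = \<mu> * S m - \<epsilon> * S m" by (simp add: \<nu>_def algebra_simps)
          moreover have "2 * e + \<nu> * e \<le> \<epsilon> * \<eta> 1" using e(3) False by (simp add: algebra_simps)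
          ultimately show "\<nu> * (S m + e) \<le> \<eta> m - 2 * e"
            using ratio[OF m] unfolding distrib_left by linarith
        qed (use B.L_pos in simp)
        finally show ?thesis .
      qed
      then show "ereal \<nu> \<le> omega_X k \<zeta> 1 X"
        using m lo by (intro B.omega_X_ge_log[where p = "m - 1"]) auto
    qed
  qed
  then have "ereal \<nu> \<le> omega_hat k \<zeta> 1" unfolding omega_hat_def by (rule Liminf_bounded)
  then have "ereal \<nu> + ereal \<epsilon> \<le> omega_hat k \<zeta> 1 + ereal \<epsilon>" by (rule add_right_mono)
  then show "ereal \<mu> \<le> omega_hat k \<zeta> 1 + ereal \<epsilon>" by (simp add: \<nu>_def)
qed

section \<open>The constants as maxima and minima of finitely many ratios\<close>

lemma omega_eq:
  assumes j: "2 \<le> j" "j \<le> k + 1"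
  shows "omega k \<zeta> j = ereal (Max {\<eta> (m + 2 - j) / S m | m. j - 1 \<le> m \<and> m \<le> k})"
proof -
  define R where "R = {\<eta> (m + 2 - j) / S m | m. j - 1 \<le> m \<and> m \<le> k}"
  have R: "R = (\<lambda>m. \<eta> (m + 2 - j) / S m) ` {j - 1..k}" by (auto simp: R_def)
  have fin: "finite R" and ne: "R \<noteq> {}" using j by (auto simp: R)
  have Sm: "S m > 0" if "j - 1 \<le> m" "m \<le> k" for m
    using that j by (intro S_pos) auto
  show ?thesis
    unfolding R_def[symmetric]
  proof (rule antisym)
    obtain m where m: "j - 1 \<le> m" "m \<le> k" "Max R = \<eta> (m + 2 - j) / S m"
      using Max_in[OF fin ne] by (auto simp: R)
    show "ereal (Max R) \<le> omega k \<zeta> j" unfolding m(3) by (rule omega_ge[OF j(1) m(1,2)])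
    show "omega k \<zeta> j \<le> ereal (Max R)"
    proof (rule omega_le[OF j(1)])
      have "0 < \<eta> (m + 2 - j)" using m j by (intro eta_pos) auto
      then show "0 \<le> Max R" unfolding m(3) using Sm[OF m(1,2)] by simp
      fix m' assume m': "j - 1 \<le> m'" "m' \<le> k"
      have "\<eta> (m' + 2 - j) / S m' \<le> Max R" using m' fin by (intro Max_ge) (auto simp: R)
      then show "\<eta> (m' + 2 - j) \<le> Max R * S m'" using Sm[OF m'] by (simp add: field_simps)
    qed
  qed
qed

lemma omega_hat_1_eq:
  "omega_hat k \<zeta> 1 = ereal (Min {\<eta> m / S m | m. 1 \<le> m \<and> m \<le> k})"
proof -
  define R where "R = {\<eta> m / S m | m. 1 \<le> m \<and> m \<le> k}"
  have R: "R = (\<lambda>m. \<eta> m / S m) ` {1..k}" by (auto simp: R_def)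
  have fin: "finite R" and ne: "R \<noteq> {}" using k_pos by (auto simp: R)
  show ?thesis
    unfolding R_def[symmetric]
  proof (rule antisym)
    obtain m where m: "1 \<le> m" "m \<le> k" "Min R = \<eta> m / S m" using Min_in[OF fin ne] by (auto simp: R)
    show "omega_hat k \<zeta> 1 \<le> ereal (Min R)" unfolding m(3) by (rule omega_hat_1_le[OF m(1,2)])
    show "ereal (Min R) \<le> omega_hat k \<zeta> 1"
    proof (rule omega_hat_1_ge)
      fix m' assume m': "1 \<le> m'" "m' \<le> k"
      have "Min R \<le> \<eta> m' / S m'" using m' fin by (intro Min_le) (auto simp: R)
      moreover have "S m' > 0" using S_pos m' by simp
      ultimately show "Min R * S m' \<le> \<eta> m'" by (simp add: field_simps)
    qed
  qed
qed

end

theorem theorem2p5: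
  fixes k :: nat and q :: "nat \<Rightarrow> nat \<Rightarrow> nat" and \<eta> :: "nat \<Rightarrow> real"
    and \<zeta> :: "nat \<Rightarrow> real"
  assumes k_pos: "k \<ge> 1"
    and incr_in: "\<And>n j. n \<ge> 1 \<Longrightarrow> 1 \<le> j \<Longrightarrow> j < k \<Longrightarrow> q n j < q n (j + 1)"
    and incr_next: "\<And>n. n \<ge> 1 \<Longrightarrow> q n k < q (n + 1) 1"
    and dvd_in: "\<And>n j. n \<ge> 1 \<Longrightarrow> 1 \<le> j \<Longrightarrow> j < k \<Longrightarrow> q n j dvd q n (j + 1)"
    and dvd_next: "\<And>n. n \<ge> 1 \<Longrightarrow> q n k dvd q (n + 1) 1"
    and lim1: "(\<lambda>n. (ln (real (q (n + 1) 1)) - ln (real (q n k))) / ln (real (q (n + 1) k)))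
                 \<longlonglongrightarrow> \<eta> 1"
    and limi: "\<And>i. 2 \<le> i \<Longrightarrow> i \<le> k \<Longrightarrow>
                 (\<lambda>n. (ln (real (q (n + 1) i)) - ln (real (q (n + 1) (i - 1)))) / ln (real (q (n + 1) k)))
                 \<longlonglongrightarrow> \<eta> i"
    and lim_inf: "filterlim (\<lambda>n. ln (real (q (n + 1) 1)) / ln (real (q n k))) at_top sequentially"
    and eta_sum: "(\<Sum>i=1..k. \<eta> i) = 1"
    and eta_mono: "\<And>i. 2 \<le> i \<Longrightarrow> i \<le> k \<Longrightarrow> \<eta> (i - 1) \<le> \<eta> i"
    and eta_pos: "\<eta> 1 > 0"
    and zeta_def: "\<And>j. 1 \<le> j \<Longrightarrow> j \<le> k \<Longrightarrow> \<zeta> j = (\<Sum>n. 1 / real (q (n + 1) j))"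
  shows "omega k \<zeta> 1 = \<infinity>
    \<and> (\<forall>j\<in>{2..k+1}. omega k \<zeta> j =
          ereal (Max {\<eta> (m + 2 - j) / (\<Sum>i=1..m. \<eta> i) | m. j - 1 \<le> m \<and> m \<le> k}))
    \<and> omega_hat k \<zeta> 1 = ereal (Min {\<eta> m / (\<Sum>i=1..m. \<eta> i) | m. 1 \<le> m \<and> m \<le> k})
    \<and> (\<forall>j\<in>{2..k+1}. omega_hat k \<zeta> j = 0)"
proof -
  interpret lacunary_system k \<eta> q \<zeta>
    by unfold_locales (fact assms)+
  show ?thesis
    using omega_1 omega_eq omega_hat_1_eq omega_hat_eq_0 unfolding S_def by simp
qed

end
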